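(* Let $\mathbf{x}:U\to\mathbb{R}^3$ be a proper wavefront, $\Omega$ a tangent moving basis of $\mathbf{x}$, and $\mathbf{p}\in\Sigma(\mathbf{x})$ with $\mathrm{rank}(D\mathbf{x}(\mathbf{p}))=0$. Then the following statements are equivalent: (1) $\mathbf{x}$ is parallelly smoothable at $\mathbf{p}$. (2) $\lambda_\Omega K_\Omega\ge0$ and $H_\Omega$ does not change sign on a neighborhood $V$ of $\mathbf{p}$. (3) $\lim_{(u,v)\to\mathbf{p}}K=+\infty$, and either $\lim_{(u,v)\to\mathbf{p}}H=+\infty$ or $\lim_{(u,v)\to\mathbf{p}}H=-\infty$. (4) $\lim_{(u,v)\to\mathbf{p}}k_1=\lim_{(u,v)\to\mathbf{p}}k_2=+\infty$ or $\lim_{(u,v)\to\mathbf{p}}k_1=\lim_{(u,v)\to\mathbf{p}}k_2=-\infty$.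
   Context: All maps are $C^\infty$; $U\subset\mathbb{R}^2$ is open, with coordinates $(u,v)$. A smooth map $\mathbf{x}:U\to\mathbb{R}^3$ is a frontal if every $\mathbf{p}\in U$ has an open neighborhood $V_p\subset U$ with a smooth unit vector field $\mathbf{n}_p:V_p\to\mathbb{R}^3$ orthogonal to $\mathbf{x}_u,\mathbf{x}_v$; it is a wavefront (front) if moreover each $(\mathbf{x},\mathbf{n}_p)$ is an immersion into $\mathbb{R}^3\times S^2$. The singular set is $\Sigma(\mathbf{x})=\{\mathbf{p}\in U:\mathbf{x}\text{ is not immersive at }\mathbf{p}\}$; $\mathbf{x}$ is proper if $\Sigma(\mathbf{x})$ has empty interior. A tangent moving basis (tmb) of $\mathbf{x}$ is a smooth map $\Omega=(\mathbf{w}_1\ \mathbf{w}_2):U\to\mathcal{M}_{3\times2}(\mathbb{R})$ with linearly independent columns at each point and $\mathbf{x}_u,\mathbf{x}_v\in\mathrm{span}(\mathbf{w}_1,\mathbf{w}_2)$. Put $\mathbf{n}=\frac{\mathbf{w}_1\times\mathbf{w}_2}{\|\mathbf{w}_1\times\mathbf{w}_2\|}$, $\mathbf{I}_\Omega=\Omega^T\Omega$, $\mathbf{II}_\Omega=-\Omega^TD\mathbf{n}$, $\mu_\Omega=-\mathbf{II}_\Omega^T\mathbf{I}_\Omega^{-1}$, $\Lambda_\Omega=D\mathbf{x}^T\Omega\,\mathbf{I}_\Omega^{-1}$, $\lambda_\Omega=\det\Lambda_\Omega$, $K_\Omega=\det\mu_\Omega$, $H_\Omega=-\frac12\mathrm{tr}(\mu_\Omega\,\mathrm{adj}(\Lambda_\Omega))$.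 One has $D\mathbf{x}=\Omega\Lambda_\Omega^T$ and $D\mathbf{n}=\Omega\mu_\Omega^T$, so $\Sigma(\mathbf{x})=\lambda_\Omega^{-1}(0)$. The fundamental forms are $\begin{pmatrix} E & F \\ F & G \end{pmatrix}=D\mathbf{x}^TD\mathbf{x}$ and $\begin{pmatrix} e & f \\ f & g \end{pmatrix}=-D\mathbf{x}^TD\mathbf{n}$ on $U$; on $U\setminus\Sigma(\mathbf{x})$, $K=\frac{eg-f^2}{EG-F^2}$ and $H=\frac{eG+gE-2fF}{2(EG-F^2)}$ are the Gaussian and mean curvatures. On $U\setminus\Sigma(\mathbf{x})$: $k_1=H-\sqrt{H^2-K}$ and $k_2=H+\sqrt{H^2-K}$ where $\lambda_\Omega>0$; $k_1=H+\sqrt{H^2-K}$ and $k_2=H-\sqrt{H^2-K}$ where $\lambda_\Omega<0$. $\mathbf{x}$ is parallelly smoothable at $\mathbf{p}\in\Sigma(\mathbf{x})$ if there exist $\epsilon>0$ and an open neighborhood $V$ of $\mathbf{p}$ such that $\mathrm{rank}(D(\mathbf{x}+l\mathbf{n})(\mathbf{q}))=2$ for every $(\mathbf{q},l)\in V\times(0,\epsilon)$, or for every $(\mathbf{q},l)\in V\times(-\epsilon,0)$. Conventions: a function does not change sign on $V$ if it is $\ge0$ on all of $V$ or $\le0$ on all of $V$. Limits of $K,H,k_1,k_2$ are taken along $U\setminus\Sigma(\mathbf{x})$. *)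

theory Defs
  imports "HOL-Analysis.Analysis"
begin

section \<open>Smooth maps\<close>

text \<open>The sets below are always open, so derivatives are taken at points in the full space.
  The last clause of \<open>Ck_on\<close> lets \<open>v\<close> range over all directions; in finite dimension this is
  the same as asking for continuous partial derivatives up to order \<open>k\<close>.\<close>

primrec Ck_on :: "nat \<Rightarrow> ('a::euclidean_space \<Rightarrow> 'b::euclidean_space) \<Rightarrow> 'a set \<Rightarrow> bool" where
  "Ck_on 0 f S \<longleftrightarrow> continuous_on S f"
| "Ck_on (Suc k) f S \<longleftrightarrow>
     (\<forall>p\<in>S. f differentiable (at p)) \<and>
     (\<forall>v. Ck_on k (\<lambda>p. frechet_derivative f (at p) v) S)"

definition smooth_on :: "('a::euclidean_space \<Rightarrow> 'b::euclidean_space) \<Rightarrow> 'a set \<Rightarrow> bool" where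
  "smooth_on f S \<longleftrightarrow> (\<forall>k. Ck_on k f S)"

definition immersive_at :: "('a::euclidean_space \<Rightarrow> 'b::euclidean_space) \<Rightarrow> 'a \<Rightarrow> bool" where
  "immersive_at f p \<longleftrightarrow> f differentiable (at p) \<and> inj (frechet_derivative f (at p))"


section \<open>Frontals and wavefronts\<close>

definition deriv_u :: "(real^2 \<Rightarrow> real^3) \<Rightarrow> real^2 \<Rightarrow> real^3" where
  "deriv_u x p = column 1 (jacobian x (at p))"

definition deriv_v :: "(real^2 \<Rightarrow> real^3) \<Rightarrow> real^2 \<Rightarrow> real^3" where
  "deriv_v x p = column 2 (jacobian x (at p))"

definition unit_normal_on :: "(real^2 \<Rightarrow> real^3) \<Rightarrow> (real^2 \<Rightarrow> real^3) \<Rightarrow> (real^2) set \<Rightarrow> bool" where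
  "unit_normal_on x n V \<longleftrightarrow> smooth_on n V \<and>
     (\<forall>q\<in>V. norm (n q) = 1 \<and> orthogonal (n q) (deriv_u x q) \<and> orthogonal (n q) (deriv_v x q))"

definition frontal_on :: "(real^2 \<Rightarrow> real^3) \<Rightarrow> (real^2) set \<Rightarrow> bool" where
  "frontal_on x U \<longleftrightarrow> smooth_on x U \<and>
     (\<forall>p\<in>U. \<exists>V n. open V \<and> p \<in> V \<and> V \<subseteq> U \<and> unit_normal_on x n V)"

text \<open>A map into \<open>\<real>\<^sup>3 \<times> S\<^sup>2\<close> is an immersion iff it is one as a map into \<open>\<real>\<^sup>3 \<times> \<real>\<^sup>3\<close>,
  since \<open>S\<^sup>2\<close> is an embedded submanifold of \<open>\<real>\<^sup>3\<close>.\<close>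

definition wavefront_on :: "(real^2 \<Rightarrow> real^3) \<Rightarrow> (real^2) set \<Rightarrow> bool" where
  "wavefront_on x U \<longleftrightarrow> frontal_on x U \<and>
     (\<forall>p\<in>U. \<exists>V n. open V \<and> p \<in> V \<and> V \<subseteq> U \<and> unit_normal_on x n V \<and>
        (\<forall>q\<in>V. immersive_at (\<lambda>r. (x r, n r)) q))"

definition singular_set :: "(real^2 \<Rightarrow> real^3) \<Rightarrow> (real^2) set \<Rightarrow> (real^2) set" where
  "singular_set x U = {p \<in> U. \<not> immersive_at x p}"

definition proper_on :: "(real^2 \<Rightarrow> real^3) \<Rightarrow> (real^2) set \<Rightarrow> bool" where
  "proper_on x U \<longleftrightarrow> interior (singular_set x U) = {}"


section \<open>Tangent moving bases and their invariants\<close>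

text \<open>The type \<open>real^2^3\<close> is that of matrices with 3 rows and 2 columns.  Independence of a set
  does not see repeated vectors, hence the inequality of the two columns.\<close>

definition tangent_moving_basis ::
    "(real^2 \<Rightarrow> real^2^3) \<Rightarrow> (real^2 \<Rightarrow> real^3) \<Rightarrow> (real^2) set \<Rightarrow> bool" where
  "tangent_moving_basis \<Omega> x U \<longleftrightarrow> smooth_on \<Omega> U \<and>
     (\<forall>q\<in>U. let w1 = column 1 (\<Omega> q); w2 = column 2 (\<Omega> q) in
        w1 \<noteq> w2 \<and> independent {w1, w2} \<and>
        deriv_u x q \<in> span {w1, w2} \<and> deriv_v x q \<in> span {w1, w2})"

definition tmb_normal :: "(real^2 \<Rightarrow> real^2^3) \<Rightarrow> real^2 \<Rightarrow> real^3" where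
  "tmb_normal \<Omega> q =
     (let c = cross3 (column 1 (\<Omega> q)) (column 2 (\<Omega> q)) in (1 / norm c) *\<^sub>R c)"

definition tmb_I :: "(real^2 \<Rightarrow> real^2^3) \<Rightarrow> real^2 \<Rightarrow> real^2^2" where
  "tmb_I \<Omega> q = transpose (\<Omega> q) ** \<Omega> q"

definition tmb_II :: "(real^2 \<Rightarrow> real^2^3) \<Rightarrow> real^2 \<Rightarrow> real^2^2" where
  "tmb_II \<Omega> q = - (transpose (\<Omega> q) ** jacobian (tmb_normal \<Omega>) (at q))"

definition tmb_mu :: "(real^2 \<Rightarrow> real^2^3) \<Rightarrow> real^2 \<Rightarrow> real^2^2" where
  "tmb_mu \<Omega> q = - (transpose (tmb_II \<Omega> q) ** matrix_inv (tmb_I \<Omega> q))"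

definition tmb_Lambda ::
    "(real^2 \<Rightarrow> real^3) \<Rightarrow> (real^2 \<Rightarrow> real^2^3) \<Rightarrow> real^2 \<Rightarrow> real^2^2" where
  "tmb_Lambda x \<Omega> q = transpose (jacobian x (at q)) ** \<Omega> q ** matrix_inv (tmb_I \<Omega> q)"

definition tmb_lambda :: "(real^2 \<Rightarrow> real^3) \<Rightarrow> (real^2 \<Rightarrow> real^2^3) \<Rightarrow> real^2 \<Rightarrow> real" where
  "tmb_lambda x \<Omega> q = det (tmb_Lambda x \<Omega> q)"

text \<open>The adjugate (transposed cofactor matrix), not the adjoint.\<close>

definition adj2 :: "real^2^2 \<Rightarrow> real^2^2" where
  "adj2 A = vector [vector [A$2$2, - A$1$2], vector [- A$2$1, A$1$1]]"

definition tmb_K :: "(real^2 \<Rightarrow> real^2^3) \<Rightarrow> real^2 \<Rightarrow> real" where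
  "tmb_K \<Omega> q = det (tmb_mu \<Omega> q)"

definition tmb_H :: "(real^2 \<Rightarrow> real^3) \<Rightarrow> (real^2 \<Rightarrow> real^2^3) \<Rightarrow> real^2 \<Rightarrow> real" where
  "tmb_H x \<Omega> q = - (1/2) * trace (tmb_mu \<Omega> q ** adj2 (tmb_Lambda x \<Omega> q))"


section \<open>Classical curvatures\<close>

definition first_form :: "(real^2 \<Rightarrow> real^3) \<Rightarrow> real^2 \<Rightarrow> real^2^2" where
  "first_form x q = transpose (jacobian x (at q)) ** jacobian x (at q)"

definition second_form ::
    "(real^2 \<Rightarrow> real^3) \<Rightarrow> (real^2 \<Rightarrow> real^2^3) \<Rightarrow> real^2 \<Rightarrow> real^2^2" where
  "second_form x \<Omega> q = - (transpose (jacobian x (at q)) ** jacobian (tmb_normal \<Omega>) (at q))"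

text \<open>The four functions below are meaningful only off the singular set.  The second form is
  symmetric there, so it does not matter which off-diagonal entry is used for \<open>f\<close>.\<close>

definition gauss_curv :: "(real^2 \<Rightarrow> real^3) \<Rightarrow> (real^2 \<Rightarrow> real^2^3) \<Rightarrow> real^2 \<Rightarrow> real" where
  "gauss_curv x \<Omega> q =
     (let E = first_form x q $ 1 $ 1; F = first_form x q $ 1 $ 2; G = first_form x q $ 2 $ 2;
          e = second_form x \<Omega> q $ 1 $ 1; f = second_form x \<Omega> q $ 1 $ 2; g = second_form x \<Omega> q $ 2 $ 2
      in (e * g - f^2) / (E * G - F^2))"

definition mean_curv :: "(real^2 \<Rightarrow> real^3) \<Rightarrow> (real^2 \<Rightarrow> real^2^3) \<Rightarrow> real^2 \<Rightarrow> real" where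
  "mean_curv x \<Omega> q =
     (let E = first_form x q $ 1 $ 1; F = first_form x q $ 1 $ 2; G = first_form x q $ 2 $ 2;
          e = second_form x \<Omega> q $ 1 $ 1; f = second_form x \<Omega> q $ 1 $ 2; g = second_form x \<Omega> q $ 2 $ 2
      in (e * G + g * E - 2 * f * F) / (2 * (E * G - F^2)))"

definition princ_curv1 :: "(real^2 \<Rightarrow> real^3) \<Rightarrow> (real^2 \<Rightarrow> real^2^3) \<Rightarrow> real^2 \<Rightarrow> real" where
  "princ_curv1 x \<Omega> q =
     (let H = mean_curv x \<Omega> q; K = gauss_curv x \<Omega> q in
      if tmb_lambda x \<Omega> q > 0 then H - sqrt (H^2 - K) else H + sqrt (H^2 - K))"

definition princ_curv2 :: "(real^2 \<Rightarrow> real^3) \<Rightarrow> (real^2 \<Rightarrow> real^2^3) \<Rightarrow> real^2 \<Rightarrow> real" where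
  "princ_curv2 x \<Omega> q =
     (let H = mean_curv x \<Omega> q; K = gauss_curv x \<Omega> q in
      if tmb_lambda x \<Omega> q > 0 then H + sqrt (H^2 - K) else H - sqrt (H^2 - K))"


section \<open>Parallel smoothability\<close>

definition parallelly_smoothable_at ::
    "(real^2 \<Rightarrow> real^3) \<Rightarrow> (real^2 \<Rightarrow> real^2^3) \<Rightarrow> (real^2) set \<Rightarrow> real^2 \<Rightarrow> bool" where
  "parallelly_smoothable_at x \<Omega> U p \<longleftrightarrow>
     (\<exists>\<epsilon>>0. \<exists>V. open V \<and> p \<in> V \<and> V \<subseteq> U \<and>
        ((\<forall>q\<in>V. \<forall>l\<in>{0<..<\<epsilon>}. rank (jacobian (\<lambda>r. x r + l *\<^sub>R tmb_normal \<Omega> r) (at q)) = 2) \<or>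
         (\<forall>q\<in>V. \<forall>l\<in>{-\<epsilon><..<0}. rank (jacobian (\<lambda>r. x r + l *\<^sub>R tmb_normal \<Omega> r) (at q)) = 2)))"

definition no_sign_change_on :: "('a \<Rightarrow> real) \<Rightarrow> 'a set \<Rightarrow> bool" where
  "no_sign_change_on h V \<longleftrightarrow> (\<forall>q\<in>V. h q \<ge> 0) \<or> (\<forall>q\<in>V. h q \<le> 0)"

end

theory Submission
  imports Defs
begin

text \<open>Write \<open>a = \<lambda>\<^sub>\<Omega>\<close>, \<open>b = H\<^sub>\<Omega>\<close>, \<open>c = K\<^sub>\<Omega>\<close>.  Since \<open>Dx = \<Omega> \<Lambda>\<^sup>T\<close> and \<open>Dn = \<Omega> \<mu>\<^sup>T\<close>, the parallel map
  \<open>x + l n\<close> is immersive exactly where \<open>a - 2 l b + l\<^sup>2 c = det (\<Lambda> + l \<mu>) \<noteq> 0\<close>, and \<open>K = c / a\<close>,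
  \<open>H = b / a\<close> off the singular set.  At a point of rank 0 we have \<open>a = b = 0\<close>, while \<open>c \<noteq> 0\<close> because
  \<open>(x, n)\<close> is an immersion.  Symmetry of the second form gives \<open>a c \<le> b\<^sup>2\<close>, so the quadratic in \<open>l\<close> has
  two real roots, both tending to 0.  Each of the four statements says that, near the
  point, \<open>a\<close> has the sign of \<open>c\<close> and \<open>b\<close> has constant sign, that is, that both roots stay on one side
  of 0.\<close>

section \<open>Root location and curvature limits\<close>

text \<open>Two obstacles shape the proof. The immersion hypothesis of a wavefront concerns some
  local unit normal, not \<open>tmb_normal \<Omega>\<close>. At regular points the two agree up to
  sign; regular points are dense by properness, so by continuity they agree up to a locally constant
  sign everywhere. This one comparison transfers the immersion property and also yields the C1
  regularity of \<open>tmb_normal \<Omega>\<close>, so that the quotient defining it never has to be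
  differentiated. The limits in (3) and (4) see only regular points, whereas (1) and (2) speak of
  full neighborhoods. At singular points a = 0, which settles the conditions on a; the sign of b is
  carried there by density and continuity. Signs reduce to one case, c(p) > 0 with both roots at or
  to the left of 0: negating b and H reflects l, while negating a, b and c together changes neither
  K, nor H, nor the zeros in l.\<close>

text \<open>For c > 0 the roots have product a / c and sum 2 b / c; being real, both are \<le> 0
  exactly when a \<ge> 0 and b \<le> 0, which is \<open>good\<close>. The last claim needs only the
  larger principal curvature, since its divergence to \<open>at_bot\<close> drags the smaller one
  along.\<close>

lemma curvature_blowup_one_sided:
  fixes a b c K H :: "'a::t2_space \<Rightarrow> real"
  assumes B: "open B" "p \<in> B" "B \<subseteq> closure R"
    and cont: "continuous_on B a" "continuous_on B b" "continuous_on B c"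
    and p: "a p = 0" "b p = 0" "c p > 0"
    and disc: "\<And>q. q \<in> B \<Longrightarrow> a q * c q \<le> (b q)\<^sup>2"
    and R: "\<And>q. q \<in> B \<Longrightarrow> q \<in> R \<longleftrightarrow> a q \<noteq> 0"
    and K: "\<And>q. q \<in> B \<Longrightarrow> q \<in> R \<Longrightarrow> K q = c q / a q"
    and H: "\<And>q. q \<in> B \<Longrightarrow> q \<in> R \<Longrightarrow> H q = b q / a q"
  defines "L \<equiv> at p within R"
  defines "good \<equiv> \<forall>\<^sub>F q in nhds p. a q \<ge> 0 \<and> b q \<le> 0"
  shows "(\<exists>\<epsilon>>0. \<forall>\<^sub>F q in nhds p. \<forall>l\<in>{0<..<\<epsilon>}. a q - 2 * l * b q + l\<^sup>2 * c q \<noteq> 0) \<longleftrightarrow> good"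
    and "filterlim K at_top L \<and> filterlim H at_bot L \<longleftrightarrow> good"
    and "filterlim (\<lambda>q. H q + sqrt ((H q)\<^sup>2 - K q)) at_bot L \<longleftrightarrow> good"
proof -
  have lim_a: "(a \<longlongrightarrow> 0) (nhds p)" and lim_b: "(b \<longlongrightarrow> 0) (nhds p)" and lim_c: "(c \<longlongrightarrow> c p) (nhds p)"
    using cont B(1,2) p by (metis continuous_on_eq_continuous_at isCont_def tendsto_at_iff_tendsto_nhds)+
  have evB: "\<forall>\<^sub>F q in nhds p. q \<in> B" using B eventually_nhds by blast
  have evc: "\<forall>\<^sub>F q in nhds p. c q > 0" using lim_c p(3) by (rule order_tendstoD)
  define F where "F = (\<lambda>q. b q + sqrt ((b q)\<^sup>2 - a q * c q))"
  have limsq: "((\<lambda>q. sqrt ((b q)\<^sup>2 - a q * c q)) \<longlongrightarrow> 0) (nhds p)"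
    by (rule tendsto_eq_intros lim_a lim_b lim_c refl | simp)+
  have LN: "L \<le> nhds p" unfolding L_def by (rule at_within_le_nhds)
  have ev: "eventually P L" if "eventually P (nhds p)" for P using LN that filter_leD by blast
  have evR: "\<forall>\<^sub>F q in L. q \<in> R" unfolding L_def by (simp add: eventually_at_topological) blast
  have ev0: "\<forall>\<^sub>F q in L. q \<in> B \<and> q \<in> R \<and> c q > 0"
    using ev[OF evB] ev[OF evc] evR by eventually_elim simp
  have disc': "K q \<le> (H q)\<^sup>2" if "q \<in> B" "q \<in> R" for q
  proof -
    have a: "a q \<noteq> 0" using R that by blast
    have "c q / a q = (a q * c q) / (a q)\<^sup>2" using a by (simp add: power2_eq_square)
    also have "\<dots> \<le> (b q)\<^sup>2 / (a q)\<^sup>2" using disc[OF that(1)] by (intro divide_right_mono) auto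
    finally show ?thesis using K H that by (simp add: power_divide)
  qed

  have A1: "good" if e: "\<epsilon> > 0" and nz: "\<forall>\<^sub>F q in nhds p. \<forall>l\<in>{0<..<\<epsilon>}. a q - 2 * l * b q + l\<^sup>2 * c q \<noteq> 0" for \<epsilon>
  proof -
    \<comment> \<open>The larger root. It tends to 0, so near \<open>p\<close> it lies below
      \<open>\<epsilon>\<close>, and the absence of roots in (0, \<open>\<epsilon>\<close>) leaves
      only \<open>r q \<le> 0\<close>.\<close>
    define r where "r = (\<lambda>q. (b q + sqrt ((b q)\<^sup>2 - a q * c q)) / c q)"
    have "(r \<longlongrightarrow> 0) (nhds p)" unfolding r_def
      by (rule tendsto_eq_intros lim_b lim_c limsq refl | use p in simp)+
    then have evr: "\<forall>\<^sub>F q in nhds p. r q < \<epsilon>" using e by (rule order_tendstoD)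
    show ?thesis unfolding good_def using evr nz evB evc
    proof eventually_elim
      case (elim q)
      let ?s = "sqrt ((b q)\<^sup>2 - a q * c q)"
      have s2: "?s\<^sup>2 = (b q)\<^sup>2 - a q * c q" using disc elim by simp
      have rc: "r q * c q = b q + ?s" using elim by (simp add: r_def)
      have "c q * (a q - 2 * r q * b q + (r q)\<^sup>2 * c q) = a q * c q - 2 * (r q * c q) * b q + (r q * c q)\<^sup>2"
        by (simp add: power2_eq_square algebra_simps)
      also have "\<dots> = 0" unfolding rc using s2 by (simp add: power2_eq_square algebra_simps)
      finally have "a q - 2 * r q * b q + (r q)\<^sup>2 * c q = 0" using elim by simp
      then have "r q \<le> 0" using elim by force
      then have le: "b q + ?s \<le> 0" using rc elim by (metis mult_nonpos_nonneg less_imp_le)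
      have s0: "0 \<le> ?s" using disc elim by simp
      \<comment> \<open>From 0 \<le> s \<le> -b, squaring gives b^2 - a c \<le> b^2, that is a c
        \<ge> 0.\<close>
      have "?s\<^sup>2 \<le> (- b q)\<^sup>2" using le s0 by (intro power_mono) auto
      then have "0 \<le> a q * c q" using s2 by simp
      then have "0 \<le> a q" using elim by (simp add: zero_le_mult_iff)
      moreover have "b q \<le> 0" using le s0 by linarith
      ultimately show ?case ..
    qed
  qed
  \<comment> \<open>All three terms are nonnegative for every l > 0 and the last is positive, so the
    bound 1 is arbitrary.\<close>
  have A2: "\<forall>\<^sub>F q in nhds p. \<forall>l\<in>{0<..<1}. a q - 2 * l * b q + l\<^sup>2 * c q \<noteq> 0" if good
    using that[unfolded good_def] evc
  proof eventually_elim
    case (elim q)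
    show ?case
    proof
      fix l :: real assume l: "l \<in> {0<..<1}"
      have "l\<^sup>2 * c q > 0" "2 * l * b q \<le> 0" using l elim by (auto simp: mult_nonneg_nonpos)
      then show "a q - 2 * l * b q + l\<^sup>2 * c q \<noteq> 0" using elim by linarith
    qed
  qed
  show "(\<exists>\<epsilon>>0. \<forall>\<^sub>F q in nhds p. \<forall>l\<in>{0<..<\<epsilon>}. a q - 2 * l * b q + l\<^sup>2 * c q \<noteq> 0) \<longleftrightarrow> good"
    using A1 A2 zero_less_one by blast

  have A3: "filterlim K at_top L \<and> filterlim H at_bot L" if good
  proof
    have evg: "\<forall>\<^sub>F q in L. a q > 0 \<and> b q \<le> 0"
      using ev[OF that[unfolded good_def]] ev0 by eventually_elim (use R in force)
    have "filterlim (\<lambda>q. inverse (a q)) at_top L"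
      using tendsto_mono[OF LN lim_a] evg
      by (intro filterlim_inverse_at_top) (auto elim: eventually_mono)
    then have "filterlim (\<lambda>q. c q * inverse (a q)) at_top L"
      using tendsto_mono[OF LN lim_c] p(3) by (intro filterlim_tendsto_pos_mult_at_top)
    then show K_top: "filterlim K at_top L"
      by (rule filterlim_mono_eventually) (use ev0 K in \<open>auto elim!: eventually_mono simp: divide_inverse\<close>)
    \<comment> \<open>H = b / a is indeterminate, as a and b both vanish at \<open>p\<close>. The
      inequality K \<le> H^2 supplies the lower bound sqrt K for |H| instead.\<close>
    have "filterlim (\<lambda>q. sqrt (K q)) at_top L"
      by (rule filterlim_compose[OF sqrt_at_top K_top])
    then have "filterlim (\<lambda>q. - H q) at_top L"
    proof (rule filterlim_at_top_mono)
      show "\<forall>\<^sub>F q in L. sqrt (K q) \<le> - H q" using evg ev0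
      proof eventually_elim
        case (elim q)
        then have "H q \<le> 0" using H by (simp add: divide_nonpos_pos)
        moreover have "sqrt (K q) \<le> \<bar>H q\<bar>" using disc' elim by (metis real_sqrt_abs real_sqrt_le_mono)
        ultimately show ?case by simp
      qed
    qed
    then show "filterlim H at_bot L" by (simp add: filterlim_uminus_at_top)
  qed
  have A4: good if "filterlim K at_top L" "filterlim H at_bot L"
  proof -
    have "\<forall>\<^sub>F q in L. K q > 0" "\<forall>\<^sub>F q in L. H q < 0"
      using that by (simp_all add: filterlim_at_top_dense filterlim_at_bot_dense)
    with ev0 have "\<forall>\<^sub>F q in L. a q > 0 \<and> b q < 0"
    proof eventually_elim
      case (elim q)
      then have "a q > 0" using K by (auto simp: zero_less_divide_iff)
      then show ?case using elim H by (auto simp: divide_less_0_iff)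
    qed
    then obtain S where S: "open S" "p \<in> S" "\<And>q. q \<in> S \<Longrightarrow> q \<noteq> p \<Longrightarrow> q \<in> R \<Longrightarrow> a q > 0 \<and> b q < 0"
      unfolding L_def eventually_at_topological by blast
    \<comment> \<open>The filter \<open>L\<close> ignores \<open>p\<close>, which costs nothing
      because \<open>p\<close> is not regular.\<close>
    have "p \<notin> R" using R B p by blast
    have reg: "a q > 0 \<and> b q < 0" if "q \<in> S" "q \<in> R" for q
      using S that \<open>p \<notin> R\<close> by blast
    have "a q \<ge> 0 \<and> b q \<le> 0" if q: "q \<in> S \<inter> B" for q
    proof
      show "a q \<ge> 0" using reg R q by (cases "q \<in> R") force+
      show "b q \<le> 0"
      proof (rule ccontr)
        assume "\<not> b q \<le> 0"
        \<comment> \<open>If b were positive at \<open>q\<close>, it would be so on the open set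
          \<open>W\<close>, which meets the dense set \<open>R\<close>, where b < 0.\<close>
        define W where "W = S \<inter> B \<inter> b -` {0<..}"
        have "continuous_on (S \<inter> B) b" using cont(2) continuous_on_subset by blast
        then have "open W" unfolding W_def using S B by (intro continuous_open_preimage) auto
        moreover have "q \<in> W" using q \<open>\<not> b q \<le> 0\<close> by (auto simp: W_def)
        moreover have "q \<in> closure R" using B q by blast
        ultimately obtain y where "y \<in> W" "y \<in> R"
          using open_Int_closure_eq_empty[of W R] by blast
        then show False using reg[of y] by (auto simp: W_def)
      qed
    qed
    moreover have "\<forall>\<^sub>F q in nhds p. q \<in> S \<inter> B" using S B by (intro eventually_nhds_in_open) auto
    ultimately show ?thesis unfolding good_def by (auto elim: eventually_mono)
  qed
  show KH: "filterlim K at_top L \<and> filterlim H at_bot L \<longleftrightarrow> good" using A3 A4 by blast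

  have A5: "filterlim (\<lambda>q. H q + sqrt ((H q)\<^sup>2 - K q)) at_bot L" if g: good
  proof -
    have evg: "\<forall>\<^sub>F q in L. a q > 0 \<and> b q \<le> 0"
      using ev[OF g[unfolded good_def]] ev0 by eventually_elim (use R in force)
    \<comment> \<open>With s the square root, (b + s) (b - s) = a c. Hence (b + s) / a, where both
      parts tend to 0, equals c / d with c bounded away from 0 and d tending to 0 from
      below.\<close>
    define d where "d = (\<lambda>q. b q - sqrt ((b q)\<^sup>2 - a q * c q))"
    have "(d \<longlongrightarrow> 0) (nhds p)" unfolding d_def by (rule tendsto_eq_intros lim_b limsq refl | simp)+
    then have "(d \<longlongrightarrow> 0) L" by (rule tendsto_mono[OF LN])
    have dneg: "\<forall>\<^sub>F q in L. d q < 0 \<and> H q + sqrt ((H q)\<^sup>2 - K q) = c q * inverse (d q)" using evg ev0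
    proof eventually_elim
      case (elim q)
      have s0: "sqrt ((b q)\<^sup>2 - a q * c q) \<ge> 0" using disc elim by simp
      have s2: "(sqrt ((b q)\<^sup>2 - a q * c q))\<^sup>2 = (b q)\<^sup>2 - a q * c q" using disc elim by simp
      have pos: "a q * c q > 0" using elim by simp
      \<comment> \<open>At a regular point b^2 \<ge> a c > 0 excludes b = 0, so d is strictly
        negative.\<close>
      have "0 < (b q)\<^sup>2" using disc[of q] elim pos by linarith
      then have "b q \<noteq> 0" by auto
      then have "b q < 0" using elim by simp
      then have dq: "d q < 0" using s0 unfolding d_def by linarith
      have "(H q)\<^sup>2 - K q = ((b q)\<^sup>2 - a q * c q) / (a q)\<^sup>2"
        using elim H K by (simp add: field_simps power2_eq_square)
      then have "sqrt ((H q)\<^sup>2 - K q) = sqrt ((b q)\<^sup>2 - a q * c q) / a q"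
        using elim by (simp add: real_sqrt_divide)
      then have "H q + sqrt ((H q)\<^sup>2 - K q) = (b q + sqrt ((b q)\<^sup>2 - a q * c q)) / a q"
        using elim H by (simp add: add_divide_distrib)
      also have "\<dots> = c q / d q"
      proof -
        have "(b q + sqrt ((b q)\<^sup>2 - a q * c q)) * d q = a q * c q"
          unfolding d_def using s2 by (simp add: power2_eq_square algebra_simps)
        then show ?thesis using dq elim by (simp add: field_simps)
      qed
      finally show ?case using dq by (simp add: divide_inverse)
    qed
    have "filterlim (\<lambda>q. inverse (d q)) at_bot L"
      using \<open>(d \<longlongrightarrow> 0) L\<close> dneg by (intro filterlim_inverse_at_bot) (auto elim: eventually_mono)
    then have "filterlim (\<lambda>q. c q * inverse (d q)) at_bot L"
      using tendsto_mono[OF LN lim_c] p(3) by (intro filterlim_tendsto_pos_mult_at_bot)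
    then show ?thesis
      by (rule filterlim_mono_eventually) (use dneg in \<open>auto elim!: eventually_mono\<close>)
  qed
  have A6: "filterlim K at_top L \<and> filterlim H at_bot L" if k: "filterlim (\<lambda>q. H q + sqrt ((H q)\<^sup>2 - K q)) at_bot L"
  proof
    \<comment> \<open>K is the product of the two principal curvatures; the smaller one and their
      mean H both lie below the larger one, which tends to minus infinity.\<close>
    have evs: "\<forall>\<^sub>F q in L. 0 \<le> sqrt ((H q)\<^sup>2 - K q)
        \<and> K q = (H q + sqrt ((H q)\<^sup>2 - K q)) * (H q - sqrt ((H q)\<^sup>2 - K q))"
      using ev0
    proof eventually_elim
      case (elim q)
      then have "K q \<le> (H q)\<^sup>2" using disc' by blast
      then show ?case by (simp add: algebra_simps flip: power2_eq_square)
    qed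
    show "filterlim H at_bot L"
      by (rule filterlim_at_bot_mono[OF k]) (use evs in \<open>auto elim: eventually_mono\<close>)
    have k': "filterlim (\<lambda>q. H q - sqrt ((H q)\<^sup>2 - K q)) at_bot L"
      by (rule filterlim_at_bot_mono[OF k]) (use evs in \<open>auto elim: eventually_mono\<close>)
    have "filterlim (\<lambda>q. (H q + sqrt ((H q)\<^sup>2 - K q)) * (H q - sqrt ((H q)\<^sup>2 - K q))) at_top L"
      using filterlim_at_top_mult_at_top[OF k[unfolded filterlim_uminus_at_bot] k'[unfolded filterlim_uminus_at_bot]]
      by (simp only: minus_mult_minus)
    then show "filterlim K at_top L"
      by (rule filterlim_mono_eventually) (use evs in \<open>auto elim!: eventually_mono\<close>)
  qed
  show "filterlim (\<lambda>q. H q + sqrt ((H q)\<^sup>2 - K q)) at_bot L \<longleftrightarrow> good"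
    using A5 A6 KH by blast
qed

text \<open>The one-sided lemma is applied to (b, H) and to (-b, -H); the second use covers negative
  l. As c > 0 near \<open>p\<close>, the signs of a c and a agree, so \<open>semidefinite\<close> is
  the disjunction of the two patterns \<open>minus\<close> and \<open>plus\<close>.\<close>

lemma curvature_blowup_pos:
  fixes a b c K H :: "'a::t2_space \<Rightarrow> real"
  assumes B: "open B" "p \<in> B" "B \<subseteq> closure R"
    and cont: "continuous_on B a" "continuous_on B b" "continuous_on B c"
    and p: "a p = 0" "b p = 0" "c p > 0"
    and disc: "\<And>q. q \<in> B \<Longrightarrow> a q * c q \<le> (b q)\<^sup>2"
    and R: "\<And>q. q \<in> B \<Longrightarrow> q \<in> R \<longleftrightarrow> a q \<noteq> 0"
    and K: "\<And>q. q \<in> B \<Longrightarrow> q \<in> R \<Longrightarrow> K q = c q / a q"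
    and H: "\<And>q. q \<in> B \<Longrightarrow> q \<in> R \<Longrightarrow> H q = b q / a q"
  defines "L \<equiv> at p within R"
  defines "semidefinite \<equiv> (\<forall>\<^sub>F q in nhds p. a q * c q \<ge> 0) \<and>
    ((\<forall>\<^sub>F q in nhds p. b q \<ge> 0) \<or> (\<forall>\<^sub>F q in nhds p. b q \<le> 0))"
  shows "(\<exists>\<epsilon>>0. \<forall>\<^sub>F q in nhds p. \<forall>l\<in>{0<..<\<epsilon>}. a q - 2 * l * b q + l\<^sup>2 * c q \<noteq> 0) \<or>
         (\<exists>\<epsilon>>0. \<forall>\<^sub>F q in nhds p. \<forall>l\<in>{-\<epsilon><..<0}. a q - 2 * l * b q + l\<^sup>2 * c q \<noteq> 0) \<longleftrightarrow> semidefinite"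
    and "filterlim K at_top L \<and> (filterlim H at_top L \<or> filterlim H at_bot L) \<longleftrightarrow> semidefinite"
    and "filterlim (\<lambda>q. H q - sqrt ((H q)\<^sup>2 - K q)) at_top L \<or>
         filterlim (\<lambda>q. H q + sqrt ((H q)\<^sup>2 - K q)) at_bot L \<longleftrightarrow> semidefinite"
proof -
  define minus where "minus \<longleftrightarrow> (\<forall>\<^sub>F q in nhds p. a q \<ge> 0 \<and> b q \<le> 0)"
  define plus where "plus \<longleftrightarrow> (\<forall>\<^sub>F q in nhds p. a q \<ge> 0 \<and> - b q \<le> 0)"
  have "(c \<longlongrightarrow> c p) (nhds p)"
    using cont B(1,2) by (metis continuous_on_eq_continuous_at isCont_def tendsto_at_iff_tendsto_nhds)
  then have "\<forall>\<^sub>F q in nhds p. c q > 0" using p(3) by (rule order_tendstoD)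
  then have "\<forall>\<^sub>F q in nhds p. (a q * c q \<ge> 0) = (a q \<ge> 0)"
    by eventually_elim (simp add: zero_le_mult_iff)
  then have "(\<forall>\<^sub>F q in nhds p. a q * c q \<ge> 0) \<longleftrightarrow> (\<forall>\<^sub>F q in nhds p. a q \<ge> 0)" by (rule eventually_cong)
  then have sd: "minus \<or> plus \<longleftrightarrow> semidefinite"
    unfolding minus_def plus_def semidefinite_def by (auto simp: eventually_conj_iff)
  note A = curvature_blowup_one_sided[OF B cont p disc R K H, folded L_def minus_def]
  note A' = curvature_blowup_one_sided[OF B cont(1) continuous_on_minus[OF cont(2)] cont(3), of K "\<lambda>q. - H q", folded L_def plus_def]
  have A'1: "(\<exists>\<epsilon>>0. \<forall>\<^sub>F q in nhds p. \<forall>l\<in>{0<..<\<epsilon>}. a q - 2 * l * (- b q) + l\<^sup>2 * c q \<noteq> 0) \<longleftrightarrow> plus"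
    using p disc R K H by (intro A') auto
  have A'2: "filterlim K at_top L \<and> filterlim (\<lambda>q. - H q) at_bot L \<longleftrightarrow> plus"
    using p disc R K H by (intro A') auto
  have A'3: "filterlim (\<lambda>q. - H q + sqrt ((- H q)\<^sup>2 - K q)) at_bot L \<longleftrightarrow> plus"
    using p disc R K H by (intro A') auto
  have refl: "(\<forall>l\<in>{-\<epsilon><..<0}. P l) \<longleftrightarrow> (\<forall>l\<in>{0<..<\<epsilon>}. P (- l))" for P and \<epsilon> :: real
  proof
    assume r: "\<forall>l\<in>{0<..<\<epsilon>}. P (- l)"
    show "\<forall>l\<in>{-\<epsilon><..<0}. P l"
    proof
      fix l assume "l \<in> {-\<epsilon><..<0}"
      then show "P l" using r[rule_format, of "- l"] by simp
    qed
  qed auto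
  show "(\<exists>\<epsilon>>0. \<forall>\<^sub>F q in nhds p. \<forall>l\<in>{0<..<\<epsilon>}. a q - 2 * l * b q + l\<^sup>2 * c q \<noteq> 0) \<or>
         (\<exists>\<epsilon>>0. \<forall>\<^sub>F q in nhds p. \<forall>l\<in>{-\<epsilon><..<0}. a q - 2 * l * b q + l\<^sup>2 * c q \<noteq> 0) \<longleftrightarrow> semidefinite"
    using A(1) A'1 sd unfolding refl by simp
  show "filterlim K at_top L \<and> (filterlim H at_top L \<or> filterlim H at_bot L) \<longleftrightarrow> semidefinite"
    using A(2) A'2 sd unfolding filterlim_uminus_at_top[of H] by blast
  \<comment> \<open>Negating H exchanges the principal curvatures up to sign, so the larger one for
    -H is minus the smaller one for H.\<close>
  have eq: "- (H q - sqrt ((H q)\<^sup>2 - K q)) = - H q + sqrt ((- H q)\<^sup>2 - K q)" for q by simp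
  show "filterlim (\<lambda>q. H q - sqrt ((H q)\<^sup>2 - K q)) at_top L \<or>
         filterlim (\<lambda>q. H q + sqrt ((H q)\<^sup>2 - K q)) at_bot L \<longleftrightarrow> semidefinite"
    using A(3) A'3 sd unfolding filterlim_uminus_at_top[of "\<lambda>q. H q - sqrt ((H q)\<^sup>2 - K q)"] eq by blast
qed

text \<open>If c p < 0, the triple (-a, -b, -c) satisfies the positive case with the same K and H;
  the products a c and b^2 are unchanged, and the two alternatives for the sign of b are
  exchanged.\<close>

lemma curvature_blowup:
  fixes a b c K H :: "'a::t2_space \<Rightarrow> real"
  assumes B: "open B" "p \<in> B" "B \<subseteq> closure R"
    and cont: "continuous_on B a" "continuous_on B b" "continuous_on B c"
    and p: "a p = 0" "b p = 0" "c p \<noteq> 0"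
    and disc: "\<And>q. q \<in> B \<Longrightarrow> a q * c q \<le> (b q)\<^sup>2"
    and R: "\<And>q. q \<in> B \<Longrightarrow> q \<in> R \<longleftrightarrow> a q \<noteq> 0"
    and K: "\<And>q. q \<in> B \<Longrightarrow> q \<in> R \<Longrightarrow> K q = c q / a q"
    and H: "\<And>q. q \<in> B \<Longrightarrow> q \<in> R \<Longrightarrow> H q = b q / a q"
  defines "L \<equiv> at p within R"
  defines "semidefinite \<equiv> (\<forall>\<^sub>F q in nhds p. a q * c q \<ge> 0) \<and>
    ((\<forall>\<^sub>F q in nhds p. b q \<ge> 0) \<or> (\<forall>\<^sub>F q in nhds p. b q \<le> 0))"
  shows "(\<exists>\<epsilon>>0. \<forall>\<^sub>F q in nhds p. \<forall>l\<in>{0<..<\<epsilon>}. a q - 2 * l * b q + l\<^sup>2 * c q \<noteq> 0) \<or>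
         (\<exists>\<epsilon>>0. \<forall>\<^sub>F q in nhds p. \<forall>l\<in>{-\<epsilon><..<0}. a q - 2 * l * b q + l\<^sup>2 * c q \<noteq> 0) \<longleftrightarrow> semidefinite"
        (is ?one)
    and "filterlim K at_top L \<and> (filterlim H at_top L \<or> filterlim H at_bot L) \<longleftrightarrow> semidefinite" (is ?two)
    and "filterlim (\<lambda>q. H q - sqrt ((H q)\<^sup>2 - K q)) at_top L \<or>
         filterlim (\<lambda>q. H q + sqrt ((H q)\<^sup>2 - K q)) at_bot L \<longleftrightarrow> semidefinite" (is ?three)
proof -
  have "?one \<and> ?two \<and> ?three"
  proof (cases "c p > 0")
    case True
    show ?thesis
      using curvature_blowup_pos[OF B cont p(1,2) True disc R K H, folded L_def semidefinite_def] by blast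
  next
    case False
    have sd: "(\<forall>\<^sub>F q in nhds p. - a q * - c q \<ge> 0) \<and>
      ((\<forall>\<^sub>F q in nhds p. - b q \<ge> 0) \<or> (\<forall>\<^sub>F q in nhds p. - b q \<le> 0)) \<longleftrightarrow> semidefinite"
      unfolding semidefinite_def by auto
    have neg: "(- a q - 2 * l * (- b q) + l\<^sup>2 * (- c q) \<noteq> 0) = (a q - 2 * l * b q + l\<^sup>2 * c q \<noteq> 0)" for q l
      by (auto simp: algebra_simps)
    note N = curvature_blowup_pos[OF B continuous_on_minus[OF cont(1)] continuous_on_minus[OF cont(2)]
        continuous_on_minus[OF cont(3)], of K H, folded L_def, unfolded sd neg]
    have ?one using p disc R K H False by (intro N) auto
    moreover have ?two using p disc R K H False by (intro N) auto
    moreover have ?three using p disc R K H False by (intro N) auto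
    ultimately show ?thesis by blast
  qed
  then show ?one ?two ?three by blast+
qed

section \<open>Symmetry of second derivatives\<close>

text \<open>The mean value theorem is used twice: in direction \<open>u\<close> for the difference
  of f along two opposite sides of the parallelogram, then in direction \<open>v\<close> for the
  derivative so obtained. The second difference itself is symmetric in \<open>u\<close> and
  \<open>v\<close>.\<close>

lemma second_difference_mvt:
  fixes f :: "'a::real_normed_vector \<Rightarrow> real"
  assumes f: "\<And>y. y \<in> S \<Longrightarrow> (f has_derivative F y) (at y)"
    and A: "\<And>y. y \<in> S \<Longrightarrow> ((\<lambda>y. F y u) has_derivative A y) (at y)"
    and h: "h > 0"
    and S: "\<And>s t. 0 \<le> s \<Longrightarrow> s \<le> h \<Longrightarrow> 0 \<le> t \<Longrightarrow> t \<le> h \<Longrightarrow> q + s *\<^sub>R u + t *\<^sub>R v \<in> S"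
  shows "\<exists>s t. 0 < s \<and> s < h \<and> 0 < t \<and> t < h \<and>
    f (q + h *\<^sub>R u + h *\<^sub>R v) - f (q + h *\<^sub>R u) - f (q + h *\<^sub>R v) + f q = h\<^sup>2 * A (q + s *\<^sub>R u + t *\<^sub>R v) v"
proof -
  have Du: "((\<lambda>s. f (q + s *\<^sub>R u + t *\<^sub>R v)) has_real_derivative F (q + s *\<^sub>R u + t *\<^sub>R v) u) (at s)"
    if "0 \<le> s" "s \<le> h" "0 \<le> t" "t \<le> h" for s t
  proof -
    have "((\<lambda>s. q + s *\<^sub>R u + t *\<^sub>R v) has_derivative (\<lambda>z. z *\<^sub>R u)) (at s)"
      by (auto intro!: derivative_eq_intros)
    from has_derivative_compose[OF this f[OF S[OF that]]]
    have "((\<lambda>s. f (q + s *\<^sub>R u + t *\<^sub>R v)) has_derivative (\<lambda>z. F (q + s *\<^sub>R u + t *\<^sub>R v) (z *\<^sub>R u))) (at s)" .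
    moreover have "F (q + s *\<^sub>R u + t *\<^sub>R v) (z *\<^sub>R u) = F (q + s *\<^sub>R u + t *\<^sub>R v) u * z" for z
      using linear_scale[OF has_derivative_linear[OF f[OF S[OF that]]]] by simp
    ultimately show ?thesis by (simp add: has_field_derivative_def)
  qed
  have "\<exists>s. 0 < s \<and> s < h \<and>
     (f (q + h *\<^sub>R u + h *\<^sub>R v) - f (q + h *\<^sub>R u + 0 *\<^sub>R v)) - (f (q + 0 *\<^sub>R u + h *\<^sub>R v) - f (q + 0 *\<^sub>R u + 0 *\<^sub>R v))
      = (h - 0) * (F (q + s *\<^sub>R u + h *\<^sub>R v) u - F (q + s *\<^sub>R u + 0 *\<^sub>R v) u)"
  proof (rule MVT2[OF h])
    fix s :: real assume s: "0 \<le> s" "s \<le> h"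
    show "((\<lambda>s. f (q + s *\<^sub>R u + h *\<^sub>R v) - f (q + s *\<^sub>R u + 0 *\<^sub>R v)) has_real_derivative
            F (q + s *\<^sub>R u + h *\<^sub>R v) u - F (q + s *\<^sub>R u + 0 *\<^sub>R v) u) (at s)"
      using Du[OF s, of h] Du[OF s, of 0] h by (intro DERIV_diff) auto
  qed
  then obtain s where s: "0 < s" "s < h" and
    seq: "(f (q + h *\<^sub>R u + h *\<^sub>R v) - f (q + h *\<^sub>R u)) - (f (q + h *\<^sub>R v) - f q)
      = h * (F (q + s *\<^sub>R u + h *\<^sub>R v) u - F (q + s *\<^sub>R u + 0 *\<^sub>R v) u)"
    by auto
  have "\<exists>t. 0 < t \<and> t < h \<and> F (q + s *\<^sub>R u + h *\<^sub>R v) u - F (q + s *\<^sub>R u + 0 *\<^sub>R v) u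
      = (h - 0) * A (q + s *\<^sub>R u + t *\<^sub>R v) v"
  proof (rule MVT2[OF h])
    fix t :: real assume t: "0 \<le> t" "t \<le> h"
    let ?y = "q + s *\<^sub>R u + t *\<^sub>R v"
    have y: "?y \<in> S" using S s t by simp
    have "((\<lambda>t. q + s *\<^sub>R u + t *\<^sub>R v) has_derivative (\<lambda>z. z *\<^sub>R v)) (at t)"
      by (auto intro!: derivative_eq_intros)
    from has_derivative_compose[OF this A[OF y]]
    have "((\<lambda>t. F (q + s *\<^sub>R u + t *\<^sub>R v) u) has_derivative (\<lambda>z. A ?y (z *\<^sub>R v))) (at t)" .
    moreover have "A ?y (z *\<^sub>R v) = A ?y v * z" for z
      using linear_scale[OF has_derivative_linear[OF A[OF y]]] by simp
    ultimately show "((\<lambda>t. F (q + s *\<^sub>R u + t *\<^sub>R v) u) has_real_derivative A ?y v) (at t)"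
      by (simp add: has_field_derivative_def)
  qed
  then obtain t where "0 < t" "t < h" and
    "F (q + s *\<^sub>R u + h *\<^sub>R v) u - F (q + s *\<^sub>R u + 0 *\<^sub>R v) u = h * A (q + s *\<^sub>R u + t *\<^sub>R v) v"
    by auto
  then show ?thesis using s seq
    by (intro exI[of _ s] exI[of _ t]) (simp add: power2_eq_square algebra_simps)
qed

text \<open>Evaluating the same second difference in both orders produces two points near
  \<open>q\<close> at which the two mixed derivatives coincide; continuity at \<open>q\<close> does
  the rest.\<close>

lemma second_derivative_symmetric_real:
  fixes f :: "'a::real_normed_vector \<Rightarrow> real"
  assumes S: "open S" "q \<in> S"
    and f: "\<And>y. y \<in> S \<Longrightarrow> (f has_derivative F y) (at y)"
    and A: "\<And>y. y \<in> S \<Longrightarrow> ((\<lambda>y. F y u) has_derivative A y) (at y)"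
    and B: "\<And>y. y \<in> S \<Longrightarrow> ((\<lambda>y. F y v) has_derivative B y) (at y)"
    and cont: "continuous_on S (\<lambda>y. A y v)" "continuous_on S (\<lambda>y. B y u)"
  shows "A q v = B q u"
proof (rule ccontr)
  assume ne: "A q v \<noteq> B q u"
  \<comment> \<open>Half the supposed gap: if both values at \<open>q\<close> are within
    \<open>\<delta>\<close> of a common number, their distance is below twice
    \<open>\<delta>\<close>, the gap itself.\<close>
  define \<delta> where "\<delta> = dist (A q v) (B q u) / 2"
  have \<delta>: "\<delta> > 0" using ne by (simp add: \<delta>_def)
  have "isCont (\<lambda>y. A y v) q" "isCont (\<lambda>y. B y u) q"
    using cont S by (simp_all add: continuous_on_eq_continuous_at)
  then obtain d1 d2 where d: "d1 > 0" "d2 > 0"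
    "\<And>y. dist y q < d1 \<Longrightarrow> dist (A y v) (A q v) < \<delta>" "\<And>y. dist y q < d2 \<Longrightarrow> dist (B y u) (B q u) < \<delta>"
    using \<delta> unfolding continuous_at_eps_delta by metis
  obtain e where e: "e > 0" "ball q e \<subseteq> S" using S open_contains_ball by blast
  define r where "r = min e (min d1 d2)"
  have r: "r > 0" "r \<le> e" "r \<le> d1" "r \<le> d2" using d e by (auto simp: r_def)
  \<comment> \<open>The summand 1 keeps the denominator positive when \<open>u\<close> and
    \<open>v\<close> vanish and makes h (|u| + |v|) < r strict, so the whole parallelogram lies
    within r of \<open>q\<close>.\<close>
  define h where "h = r / (norm u + norm v + 1)"
  have N: "norm u + norm v + 1 > 0" by (smt (verit) norm_ge_zero)
  have h: "h > 0" using r N by (simp add: h_def)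
  have hr: "h * (norm u + norm v) < r"
  proof -
    have "h * (norm u + norm v) < h * (norm u + norm v + 1)" using h by simp
    also have "\<dots> = r" using N by (simp add: h_def)
    finally show ?thesis .
  qed
  have near: "dist (q + s *\<^sub>R u + t *\<^sub>R v) q < r" if "0 \<le> s" "s \<le> h" "0 \<le> t" "t \<le> h" for s t
  proof -
    have "dist (q + s *\<^sub>R u + t *\<^sub>R v) q = norm (s *\<^sub>R u + t *\<^sub>R v)" by (simp add: dist_norm)
    also have "\<dots> \<le> s * norm u + t * norm v" using that by (metis abs_of_nonneg norm_scaleR norm_triangle_ineq)
    also have "\<dots> \<le> h * norm u + h * norm v" using that by (intro add_mono mult_right_mono) auto
    finally show ?thesis using hr by (simp add: distrib_left)
  qed
  have inS: "q + s *\<^sub>R u + t *\<^sub>R v \<in> S" if "0 \<le> s" "s \<le> h" "0 \<le> t" "t \<le> h" for s t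
    using near[OF that] r e by (force simp: dist_commute)
  obtain s t where st: "0 < s" "s < h" "0 < t" "t < h"
    "f (q + h *\<^sub>R u + h *\<^sub>R v) - f (q + h *\<^sub>R u) - f (q + h *\<^sub>R v) + f q = h\<^sup>2 * A (q + s *\<^sub>R u + t *\<^sub>R v) v"
    using second_difference_mvt[OF f A h inS] by blast
  have inS': "q + s *\<^sub>R v + t *\<^sub>R u \<in> S" if "0 \<le> s" "s \<le> h" "0 \<le> t" "t \<le> h" for s t
    using inS[of t s] that by (simp add: add.commute add.left_commute)
  obtain s' t' where st': "0 < s'" "s' < h" "0 < t'" "t' < h"
    "f (q + h *\<^sub>R v + h *\<^sub>R u) - f (q + h *\<^sub>R v) - f (q + h *\<^sub>R u) + f q = h\<^sup>2 * B (q + s' *\<^sub>R v + t' *\<^sub>R u) u"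
    using second_difference_mvt[OF f B h inS'] by blast
  have sw: "q + s' *\<^sub>R v + t' *\<^sub>R u = q + t' *\<^sub>R u + s' *\<^sub>R v" "q + h *\<^sub>R v + h *\<^sub>R u = q + h *\<^sub>R u + h *\<^sub>R v"
    by (simp_all add: add.commute add.left_commute)
  have "h\<^sup>2 * A (q + s *\<^sub>R u + t *\<^sub>R v) v = h\<^sup>2 * B (q + t' *\<^sub>R u + s' *\<^sub>R v) u"
    using st(5) st'(5) unfolding sw by linarith
  then have "A (q + s *\<^sub>R u + t *\<^sub>R v) v = B (q + t' *\<^sub>R u + s' *\<^sub>R v) u" using h by simp
  moreover have "dist (A (q + s *\<^sub>R u + t *\<^sub>R v) v) (A q v) < \<delta>"
    using near[of s t] st r by (intro d) auto
  moreover have "dist (B (q + t' *\<^sub>R u + s' *\<^sub>R v) u) (B q u) < \<delta>"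
    using near[of t' s'] st' r by (intro d) auto
  ultimately have "dist (A q v) (B q u) < \<delta> + \<delta>"
    by (metis add_strict_mono dist_commute dist_triangle order_le_less_trans)
  then show False by (simp add: \<delta>_def)
qed

section \<open>Smooth maps and their mixed second derivatives\<close>

lemma smooth_on_differentiable: "smooth_on f S \<Longrightarrow> q \<in> S \<Longrightarrow> f differentiable (at q)"
  unfolding smooth_on_def by (metis Ck_on.simps(2))

lemma smooth_on_frechet_derivative: "smooth_on f S \<Longrightarrow> smooth_on (\<lambda>q. frechet_derivative f (at q) v) S"
  unfolding smooth_on_def by (metis Ck_on.simps(2))

lemma smooth_on_continuous_on: "smooth_on f S \<Longrightarrow> continuous_on S f"
  unfolding smooth_on_def by (metis Ck_on.simps(1))

lemma smooth_on_subset: "smooth_on f S \<Longrightarrow> T \<subseteq> S \<Longrightarrow> smooth_on f T"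
proof -
  have "Ck_on k f S \<Longrightarrow> T \<subseteq> S \<Longrightarrow> Ck_on k f T" for k
    by (induction k arbitrary: f) (auto intro: continuous_on_subset)
  then show "smooth_on f S \<Longrightarrow> T \<subseteq> S \<Longrightarrow> smooth_on f T" unfolding smooth_on_def by blast
qed

lemma smooth_on_has_derivative:
  "smooth_on f S \<Longrightarrow> q \<in> S \<Longrightarrow> (f has_derivative frechet_derivative f (at q)) (at q)"
  using smooth_on_differentiable frechet_derivative_works by blast

text \<open>Pairing with an arbitrary fixed vector \<open>m\<close> reduces this to the scalar
  case.\<close>

lemma second_derivative_symmetric:
  fixes f :: "'a::euclidean_space \<Rightarrow> 'b::euclidean_space"
  assumes "open S" "q \<in> S" and f: "smooth_on f S"
  shows "frechet_derivative (\<lambda>y. frechet_derivative f (at y) u) (at q) v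
       = frechet_derivative (\<lambda>y. frechet_derivative f (at y) v) (at q) u"
proof -
  define D where "D = (\<lambda>w y. frechet_derivative f (at y) w)"
  define D2 where "D2 = (\<lambda>w y z. frechet_derivative (D w) (at y) z)"
  have sD: "smooth_on (D w) S" for w
    unfolding D_def by (rule smooth_on_frechet_derivative[OF f])
  have d1: "(f has_derivative (\<lambda>w. D w y)) (at y)" if "y \<in> S" for y
    using smooth_on_has_derivative[OF f that] by (simp add: D_def)
  have d2: "(D w has_derivative D2 w y) (at y)" if "y \<in> S" for y w
    using smooth_on_has_derivative[OF sD that] by (simp add: D2_def)
  have c: "continuous_on S (\<lambda>y. D2 w y z)" for w z
    unfolding D2_def by (rule smooth_on_continuous_on[OF smooth_on_frechet_derivative[OF sD]])
  have "m \<bullet> D2 u q v = m \<bullet> D2 v q u" for m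
  proof (rule second_derivative_symmetric_real[OF assms(1,2),
        where f = "\<lambda>y. m \<bullet> f y" and F = "\<lambda>y w. m \<bullet> D w y" and u = u and v = v and
          A = "\<lambda>y w. m \<bullet> D2 u y w" and B = "\<lambda>y w. m \<bullet> D2 v y w"])
    show "continuous_on S (\<lambda>y. m \<bullet> D2 u y v)" "continuous_on S (\<lambda>y. m \<bullet> D2 v y u)"
      using c by (simp_all add: continuous_on_inner)
  next
    fix y assume y: "y \<in> S"
    show "((\<lambda>y. m \<bullet> f y) has_derivative (\<lambda>w. m \<bullet> D w y)) (at y)"
      by (rule has_derivative_inner_right[OF d1[OF y]])
    show "((\<lambda>y. m \<bullet> D u y) has_derivative (\<lambda>w. m \<bullet> D2 u y w)) (at y)"
      by (rule has_derivative_inner_right[OF d2[OF y]])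
    show "((\<lambda>y. m \<bullet> D v y) has_derivative (\<lambda>w. m \<bullet> D2 v y w)) (at y)"
      by (rule has_derivative_inner_right[OF d2[OF y]])
  qed
  then have "D2 u q v = D2 v q u" using vector_eq_ldot by blast
  then show ?thesis by (simp add: D_def D2_def)
qed

text \<open>Differentiating n . D_w f = 0 in direction z gives n . D_z D_w f = - D_z n . D_w f,
  whose left side is symmetric in w and z. Only a first derivative of \<open>n\<close> enters, which
  is what the comparison of normals provides.\<close>

lemma normal_second_form_symmetric:
  fixes f n :: "'a::euclidean_space \<Rightarrow> 'b::euclidean_space"
  assumes S: "open S" "q \<in> S" and f: "smooth_on f S" and n: "n differentiable (at q)"
    and orth: "\<And>y w. y \<in> S \<Longrightarrow> n y \<bullet> frechet_derivative f (at y) w = 0"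
  shows "frechet_derivative f (at q) u \<bullet> frechet_derivative n (at q) v
       = frechet_derivative f (at q) v \<bullet> frechet_derivative n (at q) u"
proof -
  define D where "D = (\<lambda>w y. frechet_derivative f (at y) w)"
  define N where "N = frechet_derivative n (at q)"
  have dn: "(n has_derivative N) (at q)" using n by (simp add: N_def frechet_derivative_works)
  have key: "n q \<bullet> frechet_derivative (D w) (at q) z + N z \<bullet> D w q = 0" for w z
  proof -
    have "(D w has_derivative frechet_derivative (D w) (at q)) (at q)"
      unfolding D_def by (rule smooth_on_has_derivative[OF smooth_on_frechet_derivative[OF f] S(2)])
    then have "((\<lambda>y. n y \<bullet> D w y) has_derivative
        (\<lambda>z. n q \<bullet> frechet_derivative (D w) (at q) z + N z \<bullet> D w q)) (at q)"
      by (rule has_derivative_inner[OF dn])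
    moreover have "((\<lambda>y. n y \<bullet> D w y) has_derivative (\<lambda>z. 0)) (at q)"
      by (rule has_derivative_transform_within_open[OF has_derivative_const S])
        (simp add: D_def orth)
    ultimately have "(\<lambda>z. n q \<bullet> frechet_derivative (D w) (at q) z + N z \<bullet> D w q) = (\<lambda>z. 0)"
      by (rule has_derivative_unique)
    then show ?thesis by (rule fun_cong)
  qed
  have "frechet_derivative (D u) (at q) v = frechet_derivative (D v) (at q) u"
    unfolding D_def by (rule second_derivative_symmetric[OF S f])
  with key[of u v] key[of v u] have "N v \<bullet> D u q = N u \<bullet> D v q" by simp
  then show ?thesis by (simp add: D_def N_def inner_commute)
qed

section \<open>Coefficients with respect to a frame\<close>

lemma independent_imp_cross3_nonzero:
  assumes "independent {a, b :: real^3}" "a \<noteq> b"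
  shows "cross3 a b \<noteq> 0"
proof
  assume "cross3 a b = 0"
  then have "collinear {0, a, b}" by (simp add: cross_eq_0)
  then consider "a = 0" | "b = 0" | c where "b = c *\<^sub>R a" by (auto simp: collinear_lemma)
  then show False
  proof cases
    case 3
    then have "b \<in> span {a}" by (simp add: span_base span_scale)
    then have "dependent (insert b {a})"
      using assms(2) independent_insert[of b "{a}"] by auto
    then show False using assms by (simp add: insert_commute)
  qed (use assms dependent_zero in auto)
qed

text \<open>By the triple product expansion, r is parallel to the cross product of a and b; it is
  also orthogonal to it.\<close>

lemma orthogonal_cross3_frame_eq_0:
  assumes "r \<bullet> a = 0" "r \<bullet> b = 0" "r \<bullet> cross3 a b = 0" "cross3 a b \<noteq> 0"
  shows "r = 0"
  using assms norm_and_cross_eq_0[of r "cross3 a b"] by (auto simp: Lagrange)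

text \<open>Lagrange's identity for the Gram determinant; it makes \<open>tmb_I\<close> invertible
  and its determinant positive.\<close>

lemma det_gram:
  fixes W :: "real^2^3"
  shows "det (transpose W ** W) = (norm (cross3 (column 1 W) (column 2 W)))\<^sup>2"
  unfolding power2_norm_eq_inner
  by (simp add: det_2 matrix_matrix_mult_def transpose_def column_def cross3_def inner_vec_def sum_3 vector_3)
     (simp add: algebra_simps)

lemma matrix_inv_inverse:
  fixes A :: "real^'n^'n"
  assumes "det A \<noteq> 0"
  shows "A ** matrix_inv A = mat 1" "matrix_inv A ** A = mat 1"
proof -
  have "invertible A" using assms by (simp add: invertible_det_nz)
  then have "A ** matrix_inv A = mat 1 \<and> matrix_inv A ** A = mat 1"
    unfolding invertible_def matrix_inv_def by (rule someI_ex)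
  then show "A ** matrix_inv A = mat 1" "matrix_inv A ** A = mat 1" by (rule conjunct1, rule conjunct2)
qed

lemma scaleR_matrix_mul_right: "A ** (k *\<^sub>R B) = k *\<^sub>R (A ** B)" for A :: "real^'n^'m"
  by (simp add: vec_eq_iff matrix_matrix_mult_def sum_distrib_left mult.left_commute)

text \<open>\<open>matrix_inv\<close> is defined by choice; the adjugate formula makes its symmetry
  and continuity visible in the entries.\<close>

lemma matrix_inv_2x2:
  fixes A :: "real^2^2"
  assumes "det A \<noteq> 0"
  shows "matrix_inv A = (1 / det A) *\<^sub>R adj2 A"
proof -
  have "A ** adj2 A = det A *\<^sub>R mat 1"
    by (simp add: vec_eq_iff forall_2 matrix_matrix_mult_def adj2_def sum_2 mat_def det_2)
  then have "A ** ((1 / det A) *\<^sub>R adj2 A) = mat 1"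
    using assms by (simp add: scaleR_matrix_mul_right)
  moreover have "matrix_inv A ** A = mat 1" using assms by (rule matrix_inv_inverse)
  ultimately show ?thesis
    using matrix_mul_assoc[of "matrix_inv A" A "(1 / det A) *\<^sub>R adj2 A"] by simp
qed

text \<open>The normal equations of least squares: row j holds the coefficients of column j of
  \<open>X\<close> in the columns of \<open>W\<close>. \<open>tmb_Lambda\<close> and
  \<open>tmb_mu\<close> are the cases where \<open>X\<close> is Dx and Dn, and so share all facts
  about it.\<close>

definition frame_coeffs :: "real^2^3 \<Rightarrow> real^2^3 \<Rightarrow> real^2^2" where
  "frame_coeffs W X = transpose X ** W ** matrix_inv (transpose W ** W)"

lemma tmb_Lambda_eq: "tmb_Lambda x \<Omega> q = frame_coeffs (\<Omega> q) (jacobian x (at q))"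
  by (simp add: tmb_Lambda_def frame_coeffs_def tmb_I_def)

lemma uminus_matrix_mul: "(- A) ** B = - (A ** B)" for A :: "real^'n^'m"
  by (simp add: vec_eq_iff matrix_matrix_mult_def sum_negf)

lemma transpose_uminus: "transpose (- A) = - transpose A" for A :: "real^'n^'m"
  by (simp add: vec_eq_iff transpose_def)

text \<open>The minus signs in \<open>tmb_II\<close> and \<open>tmb_mu\<close> cancel.\<close>

lemma tmb_mu_eq: "tmb_mu \<Omega> q = frame_coeffs (\<Omega> q) (jacobian (tmb_normal \<Omega>) (at q))"
  by (simp add: tmb_mu_def tmb_II_def frame_coeffs_def tmb_I_def transpose_uminus uminus_matrix_mul
      matrix_transpose_mul)

lemma transpose_matrix_inv_2x2:
  fixes A :: "real^2^2"
  assumes "det A \<noteq> 0" "transpose A = A"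
  shows "transpose (matrix_inv A) = matrix_inv A"
proof -
  have "transpose (k *\<^sub>R adj2 B) = k *\<^sub>R adj2 (transpose B)" for k B
    by (simp add: vec_eq_iff forall_2 adj2_def transpose_def)
  then show ?thesis using assms by (simp add: matrix_inv_2x2)
qed

text \<open>The residual of each column is orthogonal to the columns of \<open>W\<close> by the
  normal equations, and to their cross product because both of its terms lie in their plane; hence
  it is 0.\<close>

lemma frame_coeffs_mul:
  fixes W X :: "real^2^3"
  assumes c: "cross3 (column 1 W) (column 2 W) \<noteq> 0"
    and orth: "\<And>j. column j X \<bullet> cross3 (column 1 W) (column 2 W) = 0"
  shows "X = W ** transpose (frame_coeffs W X)"
proof -
  define I where "I = transpose W ** W"
  define M where "M = transpose (frame_coeffs W X)"
  have d: "det I \<noteq> 0" using c by (simp add: det_gram I_def)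
  have "transpose I = I" by (simp add: I_def matrix_transpose_mul)
  with d have "transpose (matrix_inv I) = matrix_inv I" by (rule transpose_matrix_inv_2x2)
  then have "M = matrix_inv I ** (transpose W ** X)"
    unfolding M_def frame_coeffs_def I_def[symmetric] by (simp only: matrix_transpose_mul transpose_transpose)
  then have "I ** M = transpose W ** X"
    using matrix_mul_assoc[of I "matrix_inv I" "transpose W ** X"] matrix_inv_inverse(1)[OF d] by simp
  then have tr: "transpose W ** (W ** M) = transpose W ** X" by (simp add: I_def matrix_mul_assoc)
  have "column j X = column j (W ** M)" for j
  proof -
    define r where "r = column j X - column j (W ** M)"
    have "column j Y \<bullet> column i W = (transpose W ** Y) $ i $ j" for i and Y :: "real^2^3"
      by (simp add: matrix_matrix_mult_def transpose_def column_def inner_vec_def mult.commute)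
    then have r: "r \<bullet> column i W = 0" for i by (simp add: r_def inner_diff_left tr)
    have "column j (W ** M) = (M $ 1 $ j) *\<^sub>R column 1 W + (M $ 2 $ j) *\<^sub>R column 2 W"
      by (simp add: vec_eq_iff column_def matrix_matrix_mult_def sum_2 mult.commute)
    then have "r \<bullet> cross3 (column 1 W) (column 2 W) = 0"
      using orth[of j] by (simp add: r_def inner_diff_left inner_add_left dot_cross_self)
    with r c have "r = 0" by (intro orthogonal_cross3_frame_eq_0)
    then show ?thesis by (simp add: r_def)
  qed
  then show ?thesis unfolding M_def[symmetric] by (simp add: vec_eq_iff column_def)
qed

text \<open>The invertible Gram matrix gives \<open>W\<close> a left inverse, so the product is
  injective exactly when the square factor is.\<close>

lemma rank_frame_mul:
  fixes W :: "real^2^3"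
  assumes c: "cross3 (column 1 W) (column 2 W) \<noteq> 0"
  shows "rank (W ** transpose A) = 2 \<longleftrightarrow> det A \<noteq> 0"
proof -
  have "det (transpose W ** W) \<noteq> 0" using c by (simp add: det_gram)
  then have "matrix_inv (transpose W ** W) ** (transpose W ** W) = mat 1" by (rule matrix_inv_inverse)
  then have "matrix_inv (transpose W ** W) ** transpose W ** W = mat 1" by (simp only: matrix_mul_assoc)
  then have W: "inj ((*v) W)" using matrix_left_invertible_injective by blast
  have "rank (W ** transpose A) = 2 \<longleftrightarrow> inj ((*v) (W ** transpose A))"
    using full_rank_injective[of "W ** transpose A"] by simp
  also have "\<dots> \<longleftrightarrow> inj ((*v) (transpose A))"
  proof -
    have "(*v) (W ** transpose A) = (*v) W \<circ> (*v) (transpose A)"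
      by (rule ext) (simp only: o_def matrix_vector_mul_assoc)
    then show ?thesis using W by (metis inj_compose inj_on_imageI2)
  qed
  also have "\<dots> \<longleftrightarrow> det A \<noteq> 0"
    using det_nz_iff_inj[of "(*v) (transpose A)"] by (simp add: det_transpose matrix_vector_mul_linear)
  finally show ?thesis .
qed

section \<open>The determinant of 2 by 2 matrices and its polarization\<close>

text \<open>trace (B adj A) is the polarization of the quadratic form det. The linear coefficient is
  written so that it matches \<open>tmb_H\<close> literally.\<close>

lemma det_add_scaleR_2x2:
  fixes A B :: "real^2^2"
  shows "det (A + l *\<^sub>R B) = det A - 2 * l * (- (1/2) * trace (B ** adj2 A)) + l\<^sup>2 * det B"
  by (simp add: det_2 trace_def sum_2 matrix_matrix_mult_def adj2_def power2_eq_square algebra_simps)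

text \<open>The adjugate reverses products, so cyclic rotation of the trace brings adj A next to A,
  and their product is the scalar det A.\<close>

lemma trace_adj2_mul_left:
  "trace ((A ** B) ** adj2 (A ** C)) = det A * trace (B ** adj2 C)"
  unfolding det_2 trace_def sum_2 matrix_matrix_mult_def adj2_def by (simp add: sum_2) algebra

lemma trace_adj2_transpose: "trace (transpose A ** adj2 (transpose B)) = trace (A ** adj2 B)"
  by (simp add: trace_def sum_2 matrix_matrix_mult_def adj2_def transpose_def)

text \<open>\<open>P\<close> and \<open>Q\<close> stand for the two fundamental forms. For symmetric
  matrices the numerator of H is trace (Q adj P), from which the common left factors
  \<open>L\<close> and \<open>S\<close> are extracted as determinants.\<close>

lemma mean_curvature_numerator:
  fixes L M S :: "real^2^2"
  assumes P: "P = L ** S ** transpose L" "P $ 2 $ 1 = P $ 1 $ 2"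
    and Q: "Q = - (L ** S ** transpose M)" "Q $ 2 $ 1 = Q $ 1 $ 2"
  shows "Q$1$1 * P$2$2 + Q$2$2 * P$1$1 - 2 * Q$1$2 * P$1$2 = 2 * (det S * det L * (- (1/2) * trace (M ** adj2 L)))"
proof -
  have "Q$1$1 * P$2$2 + Q$2$2 * P$1$1 - 2 * Q$1$2 * P$1$2 = trace (Q ** adj2 P)"
    using P(2) Q(2) by (simp add: trace_def sum_2 matrix_matrix_mult_def adj2_def)
  also have "\<dots> = - trace ((L ** (S ** transpose M)) ** adj2 (L ** (S ** transpose L)))"
    unfolding P(1) Q(1) by (simp add: matrix_mul_assoc uminus_matrix_mul) (simp add: trace_def sum_2)
  also have "\<dots> = - (det L * (det S * trace (M ** adj2 L)))"
    unfolding trace_adj2_mul_left trace_adj2_transpose ..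
  finally show ?thesis by simp
qed

text \<open>After multiplication by \<open>E\<^sup>2\<close>, the difference of the two sides is a sum of squares
  with the coefficient \<open>E G - F\<^sup>2\<close>.\<close>
lemma quadratic_forms_discriminant_nonneg:
  fixes E F G e f g :: real
  assumes "E * G - F\<^sup>2 > 0"
  shows "4 * (E * G - F\<^sup>2) * (e * g - f\<^sup>2) \<le> (e * G + g * E - 2 * f * F)\<^sup>2"
proof -
  have "E \<noteq> 0" using assms by auto
  have "E\<^sup>2 * ((e * G + g * E - 2 * f * F)\<^sup>2 - 4 * (E * G - F\<^sup>2) * (e * g - f\<^sup>2))
      = 4 * (E * G - F\<^sup>2) * (E * f - F * e)\<^sup>2 + (E * (E * g - G * e) - 2 * F * (E * f - F * e))\<^sup>2"
    by algebra
  also have "\<dots> \<ge> 0" using assms by simp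
  finally show ?thesis using \<open>E \<noteq> 0\<close> by (simp add: zero_le_mult_iff)
qed

section \<open>Continuity of the frame coefficients\<close>

lemma continuous_on_matrix_mul:
  fixes A :: "'a::topological_space \<Rightarrow> real^'n^'m" and B :: "'a \<Rightarrow> real^'k^'n"
  shows "continuous_on T A \<Longrightarrow> continuous_on T B \<Longrightarrow> continuous_on T (\<lambda>q. A q ** B q)"
  unfolding matrix_matrix_mult_def by (intro continuous_intros)

lemma continuous_on_matrix_transpose:
  fixes A :: "'a::topological_space \<Rightarrow> real^'n^'m"
  shows "continuous_on T A \<Longrightarrow> continuous_on T (\<lambda>q. transpose (A q))"
  unfolding transpose_def by (intro continuous_intros)

lemma continuous_on_det_2x2:
  fixes A :: "'a::topological_space \<Rightarrow> real^2^2"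
  shows "continuous_on T A \<Longrightarrow> continuous_on T (\<lambda>q. det (A q))"
  unfolding det_2 by (intro continuous_intros)

lemma continuous_on_adj2:
  fixes A :: "'a::topological_space \<Rightarrow> real^2^2"
  assumes "continuous_on T A"
  shows "continuous_on T (\<lambda>q. adj2 (A q))"
proof -
  have "linear adj2" by (rule linearI) (simp_all add: adj2_def vec_eq_iff forall_2)
  then have "continuous_on UNIV adj2" by (simp add: linear_continuous_on linear_conv_bounded_linear)
  from continuous_on_compose2[OF this assms] show ?thesis by simp
qed

lemma continuous_on_frame_coeffs:
  assumes "continuous_on T W" "continuous_on T X"
    and "\<And>q. q \<in> T \<Longrightarrow> cross3 (column 1 (W q)) (column 2 (W q)) \<noteq> 0"
  shows "continuous_on T (\<lambda>q. frame_coeffs (W q) (X q))"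
proof -
  let ?I = "\<lambda>q. transpose (W q) ** W q"
  have d: "det (?I q) \<noteq> 0" if "q \<in> T" for q using assms(3)[OF that] by (simp add: det_gram)
  have "continuous_on T (\<lambda>q. transpose (X q) ** W q ** ((1 / det (?I q)) *\<^sub>R adj2 (?I q)))"
    using assms(1,2) d
    by (intro continuous_on_matrix_mul continuous_on_scaleR continuous_on_adj2 continuous_on_divide
        continuous_on_det_2x2 continuous_on_matrix_transpose continuous_on_const) auto
  then show ?thesis
    by (rule continuous_on_cong[THEN iffD1, rotated 2]) (auto simp: frame_coeffs_def matrix_inv_2x2 d)
qed

section \<open>Tangent moving bases\<close>

lemma frechet_derivative_eq_jacobian:
  fixes f :: "real^'n \<Rightarrow> real^'m"
  assumes "f differentiable (at q)"
  shows "frechet_derivative f (at q) = (*v) (jacobian f (at q))"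
  unfolding jacobian_def using assms
  by (auto simp: fun_eq_iff frechet_derivative_works has_derivative_linear matrix_works)

lemma column_jacobian: "column j (jacobian f (at q)) = frechet_derivative f (at q) (axis j 1)"
  by (simp add: jacobian_def matrix_def column_def vec_eq_iff)

lemma immersive_at_iff_rank:
  fixes x :: "real^2 \<Rightarrow> real^'m"
  assumes "x differentiable (at q)"
  shows "immersive_at x q \<longleftrightarrow> rank (jacobian x (at q)) = 2"
  using assms full_rank_injective[of "jacobian x (at q)"]
  by (simp add: immersive_at_def frechet_derivative_eq_jacobian)

lemma continuous_on_jacobian:
  fixes f :: "real^'n \<Rightarrow> real^'m"
  assumes "\<And>v. continuous_on B (\<lambda>q. frechet_derivative f (at q) v)"
  shows "continuous_on B (\<lambda>q. jacobian f (at q))"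
  unfolding jacobian_def matrix_def
  by (intro continuous_on_vec_lambda continuous_on_component assms)

section \<open>Unit normals to a plane\<close>

lemma orthogonal_plane_line:
  fixes a b r :: "real^3"
  assumes "r \<bullet> a = 0" "r \<bullet> b = 0"
  shows "(norm (cross3 a b))\<^sup>2 *\<^sub>R r = (cross3 a b \<bullet> r) *\<^sub>R cross3 a b"
proof -
  have "cross3 r (cross3 a b) = 0" using assms by (simp add: Lagrange)
  then show ?thesis using Lagrange[of "cross3 a b" r "cross3 a b"] by (simp add: power2_norm_eq_inner)
qed

text \<open>Both vectors are the normalized cross product up to sign. Squaring removes the sign,
  giving a continuous condition that can be tested on a dense set.\<close>

lemma unit_normals_to_plane:
  fixes a b m n :: "real^3"
  assumes "cross3 a b \<noteq> 0" "norm m = 1" "norm n = 1"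
    and "m \<bullet> a = 0" "m \<bullet> b = 0" "n \<bullet> a = 0" "n \<bullet> b = 0"
  shows "(m \<bullet> n)\<^sup>2 = 1"
proof -
  let ?c = "cross3 a b"
  have "cross3 m ?c = 0" using assms by (simp add: Lagrange)
  then have m: "(m \<bullet> ?c)\<^sup>2 = (norm ?c)\<^sup>2" using norm_cross_dot[of m ?c] assms by simp
  have n: "(norm ?c)\<^sup>2 *\<^sub>R n = (?c \<bullet> n) *\<^sub>R ?c" using assms by (intro orthogonal_plane_line)
  have "cross3 n ?c = 0" using assms by (simp add: Lagrange)
  then have n': "(n \<bullet> ?c)\<^sup>2 = (norm ?c)\<^sup>2" using norm_cross_dot[of n ?c] assms by simp
  have "((norm ?c)\<^sup>2)\<^sup>2 * (m \<bullet> n)\<^sup>2 = (m \<bullet> ((norm ?c)\<^sup>2 *\<^sub>R n))\<^sup>2" by (simp add: power_mult_distrib)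
  also have "\<dots> = (?c \<bullet> n)\<^sup>2 * (m \<bullet> ?c)\<^sup>2" unfolding n by (simp add: power_mult_distrib)
  also have "\<dots> = ((norm ?c)\<^sup>2)\<^sup>2 * 1" using m n' by (simp add: inner_commute power2_eq_square)
  finally show ?thesis using assms(1) by simp
qed

lemma norm_tmb_normal:
  "cross3 (column 1 (\<Omega> q)) (column 2 (\<Omega> q)) \<noteq> 0 \<Longrightarrow> norm (tmb_normal \<Omega> q) = 1"
  by (simp add: tmb_normal_def Let_def)

lemma inner_tmb_normal_eq_0:
  "v \<bullet> cross3 (column 1 (\<Omega> q)) (column 2 (\<Omega> q)) = 0 \<Longrightarrow> tmb_normal \<Omega> q \<bullet> v = 0"
  by (simp add: tmb_normal_def Let_def inner_commute)

text \<open>Cancelling the factor \<open>1 / norm c\<close> is harmless: if it is 0, the cross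
  product is 0 and the conclusion is trivial.\<close>

lemma inner_tmb_normal_eq_0_imp:
  "tmb_normal \<Omega> q \<bullet> v = 0 \<Longrightarrow> v \<bullet> cross3 (column 1 (\<Omega> q)) (column 2 (\<Omega> q)) = 0"
  by (auto simp: tmb_normal_def Let_def inner_commute)

lemma span_orthogonal_cross3: "v \<in> span {a, b} \<Longrightarrow> v \<bullet> cross3 a b = 0"
  by (auto simp: span_insert span_singleton inner_diff_left dot_cross_self
      dest!: arg_cong[where f = "\<lambda>w. w \<bullet> cross3 a b"])

lemma tangent_moving_basisD:
  assumes "tangent_moving_basis \<Omega> x U" "q \<in> U"
  shows "cross3 (column 1 (\<Omega> q)) (column 2 (\<Omega> q)) \<noteq> 0"
    and "column j (jacobian x (at q)) \<bullet> cross3 (column 1 (\<Omega> q)) (column 2 (\<Omega> q)) = 0"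
proof -
  note t = assms(1)[unfolded tangent_moving_basis_def Let_def, THEN conjunct2, rule_format, OF assms(2)]
  show "cross3 (column 1 (\<Omega> q)) (column 2 (\<Omega> q)) \<noteq> 0"
    using t by (intro independent_imp_cross3_nonzero) auto
  have "j = 1 \<or> j = 2" by (rule exhaust_2)
  then show "column j (jacobian x (at q)) \<bullet> cross3 (column 1 (\<Omega> q)) (column 2 (\<Omega> q)) = 0"
    using t by (intro span_orthogonal_cross3) (auto simp: deriv_u_def deriv_v_def)
qed

lemma jacobian_eq_frame_coeffs:
  assumes "tangent_moving_basis \<Omega> x U" "q \<in> U"
  shows "jacobian x (at q) = \<Omega> q ** transpose (tmb_Lambda x \<Omega> q)"
  unfolding tmb_Lambda_eq by (rule frame_coeffs_mul) (use tangent_moving_basisD[OF assms] in auto)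

lemma immersive_at_iff_tmb_lambda:
  assumes "tangent_moving_basis \<Omega> x U" "q \<in> U" "x differentiable (at q)"
  shows "immersive_at x q \<longleftrightarrow> tmb_lambda x \<Omega> q \<noteq> 0"
  using immersive_at_iff_rank[OF assms(3)] rank_frame_mul[OF tangent_moving_basisD(1)[OF assms(1,2)]]
    jacobian_eq_frame_coeffs[OF assms(1,2)] by (simp add: tmb_lambda_def)

lemma immersive_imp_cross3_nonzero:
  fixes x :: "real^2 \<Rightarrow> real^3"
  assumes "immersive_at x q"
  shows "cross3 (column 1 (jacobian x (at q))) (column 2 (jacobian x (at q))) \<noteq> 0"
proof -
  let ?X = "jacobian x (at q)"
  have "x differentiable (at q)" using assms by (simp add: immersive_at_def)
  with assms have "rank ?X = 2" using immersive_at_iff_rank by blast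
  then have "inj ((*v) ?X)" using full_rank_injective[of ?X] by simp
  moreover have "?X *v vector [a, b] = a *\<^sub>R column 1 ?X + b *\<^sub>R column 2 ?X" for a b
    by (simp add: matrix_vector_mult_def vec_eq_iff column_def sum_2)
  ultimately have inj: "a = 0 \<and> b = 0" if "a *\<^sub>R column 1 ?X + b *\<^sub>R column 2 ?X = 0" for a b
    using that inj_eq[of "(*v) ?X" "vector [a, b]" 0] by (simp add: vec_eq_iff forall_2)
  show ?thesis
  proof
    assume "cross3 (column 1 ?X) (column 2 ?X) = 0"
    then have "collinear {0, column 1 ?X, column 2 ?X}" by (simp add: cross_eq_0)
    then consider "column 1 ?X = 0" | "column 2 ?X = 0" | c where "column 2 ?X = c *\<^sub>R column 1 ?X"
      by (auto simp: collinear_lemma)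
    then show False
      using inj[of 1 0] inj[of 0 1] inj[of c "-1" for c] by cases auto
  qed
qed

lemma transpose_mul_nth:
  fixes A B :: "real^'n^'m"
  shows "(transpose A ** B) $ i $ j = column i A \<bullet> column j B"
  by (simp add: matrix_matrix_mult_def transpose_def column_def inner_vec_def)

text \<open>Both forms factor through the Gram matrix S of the basis, P = L S L^T and Q = - L S M^T.
  So EG - F^2, eg - f^2 and the numerator of H are det S times a^2, a c and 2 a b, and the common
  factors cancel in the quotients.\<close>

lemma curvatures:
  assumes t: "tangent_moving_basis \<Omega> x U" "q \<in> U"
    and n: "\<And>j. column j (jacobian (tmb_normal \<Omega>) (at q)) \<bullet> cross3 (column 1 (\<Omega> q)) (column 2 (\<Omega> q)) = 0"
    and sym: "second_form x \<Omega> q $ 2 $ 1 = second_form x \<Omega> q $ 1 $ 2"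
    and reg: "tmb_lambda x \<Omega> q \<noteq> 0"
  shows "gauss_curv x \<Omega> q = tmb_K \<Omega> q / tmb_lambda x \<Omega> q"
    and "mean_curv x \<Omega> q = tmb_H x \<Omega> q / tmb_lambda x \<Omega> q"
    and "tmb_lambda x \<Omega> q * tmb_K \<Omega> q \<le> (tmb_H x \<Omega> q)\<^sup>2"
proof -
  define P where "P = first_form x q"
  define Q where "Q = second_form x \<Omega> q"
  define S where "S = transpose (\<Omega> q) ** \<Omega> q"
  define L where "L = tmb_Lambda x \<Omega> q"
  define M where "M = tmb_mu \<Omega> q"
  have X: "jacobian x (at q) = \<Omega> q ** transpose L"
    unfolding L_def by (rule jacobian_eq_frame_coeffs[OF t])
  have N: "jacobian (tmb_normal \<Omega>) (at q) = \<Omega> q ** transpose M"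
    unfolding M_def tmb_mu_eq by (rule frame_coeffs_mul) (use tangent_moving_basisD[OF t] n in auto)
  have S: "det S > 0" using tangent_moving_basisD(1)[OF t] by (simp add: S_def det_gram)
  have P: "P = L ** S ** transpose L"
    unfolding P_def first_form_def X S_def by (simp add: matrix_transpose_mul matrix_mul_assoc)
  have Q: "Q = - (L ** S ** transpose M)"
    unfolding Q_def second_form_def X N S_def by (simp add: matrix_transpose_mul matrix_mul_assoc)
  have Psym: "P $ 2 $ 1 = P $ 1 $ 2"
    unfolding P_def first_form_def transpose_mul_nth by (simp add: inner_commute)
  have Qsym: "Q $ 2 $ 1 = Q $ 1 $ 2" using sym by (simp add: Q_def)
  define a where "a = tmb_lambda x \<Omega> q"
  define b where "b = tmb_H x \<Omega> q"
  define c where "c = tmb_K \<Omega> q"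
  define E F G e f g where "E = P$1$1" and "F = P$1$2" and "G = P$2$2"
    and "e = Q$1$1" and "f = Q$1$2" and "g = Q$2$2"
  note entries = E_def F_def G_def e_def f_def g_def
  have a: "det L = a" "a \<noteq> 0" using reg by (simp_all add: a_def L_def tmb_lambda_def)
  have b: "- (1/2) * trace (M ** adj2 L) = b" by (simp add: b_def L_def M_def tmb_H_def)
  have c: "det M = c" by (simp add: c_def M_def tmb_K_def)
  have EG: "E * G - F\<^sup>2 = a\<^sup>2 * det S"
  proof -
    have "E * G - F\<^sup>2 = det P" using Psym by (simp add: entries det_2 power2_eq_square)
    then show ?thesis by (simp add: P det_mul det_transpose a power2_eq_square)
  qed
  have eg: "e * g - f\<^sup>2 = a * c * det S"
  proof -
    have "e * g - f\<^sup>2 = det Q" using Qsym by (simp add: entries det_2 power2_eq_square)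
    also have "\<dots> = det (L ** S ** transpose M)" unfolding Q by (simp add: det_2)
    finally show ?thesis by (simp add: det_mul det_transpose a c)
  qed
  have eG: "e * G + g * E - 2 * f * F = 2 * (det S * a * b)"
    using mean_curvature_numerator[OF P Psym Q Qsym] unfolding entries a b .
  show "gauss_curv x \<Omega> q = tmb_K \<Omega> q / tmb_lambda x \<Omega> q"
  proof -
    have "gauss_curv x \<Omega> q = (e * g - f\<^sup>2) / (E * G - F\<^sup>2)"
      by (simp add: gauss_curv_def Let_def entries P_def Q_def)
    also have "\<dots> = c / a" unfolding EG eg using S a by (simp add: power2_eq_square)
    finally show ?thesis by (simp add: a_def c_def)
  qed
  show "mean_curv x \<Omega> q = tmb_H x \<Omega> q / tmb_lambda x \<Omega> q"
  proof -
    have "mean_curv x \<Omega> q = (e * G + g * E - 2 * f * F) / (2 * (E * G - F\<^sup>2))"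
      by (simp add: mean_curv_def Let_def entries P_def Q_def)
    also have "\<dots> = b / a" unfolding EG eG using S a by (simp add: power2_eq_square)
    finally show ?thesis by (simp add: a_def b_def)
  qed
  have "4 * (E * G - F\<^sup>2) * (e * g - f\<^sup>2) \<le> (e * G + g * E - 2 * f * F)\<^sup>2"
    by (rule quadratic_forms_discriminant_nonneg) (use EG S a in simp)
  \<comment> \<open>Each side of the discriminant inequality contains this square, which is positive
    because \<open>q\<close> is regular and S is a nondegenerate Gram matrix.\<close>
  then have "(2 * a * det S)\<^sup>2 * (a * c) \<le> (2 * a * det S)\<^sup>2 * b\<^sup>2"
    unfolding EG eg eG by (simp add: power2_eq_square algebra_simps)
  moreover have "(2 * a * det S)\<^sup>2 > 0" using S a by simp
  ultimately show "tmb_lambda x \<Omega> q * tmb_K \<Omega> q \<le> (tmb_H x \<Omega> q)\<^sup>2"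
    by (simp add: a_def b_def c_def)
qed

section \<open>Comparison of the basis normal with the wavefront normal\<close>

lemma continuous_on_tmb_normal:
  assumes t: "tangent_moving_basis \<Omega> x U"
  shows "continuous_on U (tmb_normal \<Omega>)"
proof -
  have \<Omega>: "continuous_on U \<Omega>"
    using t unfolding tangent_moving_basis_def by (intro smooth_on_continuous_on) (rule conjunct1)
  have col: "continuous_on U (\<lambda>y. column j (\<Omega> y))" for j
    unfolding column_def by (intro continuous_on_vec_lambda continuous_on_component \<Omega>)
  show ?thesis
    unfolding tmb_normal_def Let_def using tangent_moving_basisD(1)[OF t]
    by (intro continuous_on_scaleR continuous_on_divide continuous_on_norm continuous_on_cross col
        continuous_on_const) auto
qed

text \<open>At a regular point both vectors are unit normals to the same plane. A failure at
  \<open>q\<close> would persist on an open set, which would consist of singular points only,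
  against properness.\<close>

lemma unit_normal_agrees:
  assumes U: "proper_on x U" "tangent_moving_basis \<Omega> x U"
    and V: "open V" "V \<subseteq> U" and n: "unit_normal_on x n V" and q: "q \<in> V"
  shows "(n q \<bullet> tmb_normal \<Omega> q)\<^sup>2 = 1"
proof (rule ccontr)
  assume ne: "(n q \<bullet> tmb_normal \<Omega> q)\<^sup>2 \<noteq> 1"
  have "continuous_on V (tmb_normal \<Omega>)"
    using continuous_on_tmb_normal[OF U(2)] V(2) by (rule continuous_on_subset)
  moreover have "continuous_on V n" using n by (simp add: unit_normal_on_def smooth_on_continuous_on)
  ultimately have "continuous_on V (\<lambda>y. (n y \<bullet> tmb_normal \<Omega> y)\<^sup>2)"
    by (intro continuous_on_power continuous_on_inner)
  then have "open (V \<inter> (\<lambda>y. (n y \<bullet> tmb_normal \<Omega> y)\<^sup>2) -` (- {1}))"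
    using V by (intro continuous_open_preimage) auto
  moreover have "V \<inter> (\<lambda>y. (n y \<bullet> tmb_normal \<Omega> y)\<^sup>2) -` (- {1}) \<subseteq> singular_set x U"
  proof
    fix y assume y: "y \<in> V \<inter> (\<lambda>y. (n y \<bullet> tmb_normal \<Omega> y)\<^sup>2) -` (- {1})"
    have "(n y \<bullet> tmb_normal \<Omega> y)\<^sup>2 = 1" if "immersive_at x y"
    proof (rule unit_normals_to_plane[OF immersive_imp_cross3_nonzero[OF that]])
      have "y \<in> U" using y V by blast
      then show "norm (tmb_normal \<Omega> y) = 1" "tmb_normal \<Omega> y \<bullet> column 1 (jacobian x (at y)) = 0"
        "tmb_normal \<Omega> y \<bullet> column 2 (jacobian x (at y)) = 0"
        using tangent_moving_basisD[OF U(2)] by (auto intro!: norm_tmb_normal inner_tmb_normal_eq_0)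
    qed (use n y in \<open>auto simp: unit_normal_on_def deriv_u_def deriv_v_def orthogonal_def\<close>)
    then show "y \<in> singular_set x U" using y V by (auto simp: singular_set_def)
  qed
  ultimately have "q \<in> interior (singular_set x U)" using ne q by (auto intro: interiorI)
  then show False using U(1) by (simp add: proper_on_def)
qed

lemma tmb_normal_C1_near:
  assumes U: "open U" "wavefront_on x U" "proper_on x U" and t: "tangent_moving_basis \<Omega> x U" and p: "p \<in> U"
  shows "\<exists>B. open B \<and> p \<in> B \<and> B \<subseteq> U \<and> (\<forall>q\<in>B. tmb_normal \<Omega> differentiable (at q)) \<and>
    (\<forall>v. continuous_on B (\<lambda>q. frechet_derivative (tmb_normal \<Omega>) (at q) v)) \<and>
    immersive_at (\<lambda>r. (x r, tmb_normal \<Omega> r)) p"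
proof -
  obtain V n where V: "open V" "p \<in> V" "V \<subseteq> U" and n: "unit_normal_on x n V"
    and imm: "immersive_at (\<lambda>r. (x r, n r)) p"
    using U(2) p unfolding wavefront_on_def by metis
  have smooth: "smooth_on n V" using n by (simp add: unit_normal_on_def)
  define N where "N = tmb_normal \<Omega>"
  define h where "h = (\<lambda>q. n q \<bullet> N q)"
  \<comment> \<open>The sign relating the two normals, 1 or -1. Where s h > 0 in fact s h = 1, so
    that |N - s n|^2 = 1 - 2 s h + s^2 = 0.\<close>
  define s where "s = h p"
  have h2: "(h q)\<^sup>2 = 1" if "q \<in> V" for q
    unfolding h_def N_def by (rule unit_normal_agrees[OF U(3) t V(1,3) n that])
  have s: "s\<^sup>2 = 1" "s \<noteq> 0" using h2[OF V(2)] by (auto simp: s_def)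
  define B where "B = V \<inter> (\<lambda>q. s * h q) -` {0<..}"
  have "continuous_on V (\<lambda>q. s * h q)"
    unfolding h_def N_def using continuous_on_subset[OF continuous_on_tmb_normal[OF t] V(3)]
      smooth_on_continuous_on[OF smooth] by (intro continuous_on_mult continuous_on_inner continuous_on_const)
  then have B: "open B" unfolding B_def using V(1) by (intro continuous_open_preimage) auto
  have pB: "p \<in> B" using V s by (simp add: B_def s_def power2_eq_square)
  have N: "N q = s *\<^sub>R n q" if q: "q \<in> B" for q
  proof -
    have qV: "q \<in> V" using q by (simp add: B_def)
    have "s * h q > 0" using q by (simp add: B_def)
    moreover have "(s * h q)\<^sup>2 = 1" using s h2[OF qV] by (simp add: power_mult_distrib)
    ultimately have sh: "s * h q = 1" by (simp add: power2_eq_1_iff)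
    have "norm (n q) = 1" using n qV by (simp add: unit_normal_on_def)
    moreover have "norm (N q) = 1"
      unfolding N_def using tangent_moving_basisD(1)[OF t] qV V by (intro norm_tmb_normal) auto
    ultimately have "n q \<bullet> n q = 1" "N q \<bullet> N q = 1" by (simp_all flip: power2_norm_eq_inner)
    then have "(N q - s *\<^sub>R n q) \<bullet> (N q - s *\<^sub>R n q) = 1 - 2 * (s * h q) + s\<^sup>2"
      by (simp add: h_def inner_diff_left inner_diff_right inner_commute power2_eq_square)
    then show ?thesis using sh s by simp
  qed
  have dn: "(n has_derivative frechet_derivative n (at q)) (at q)" if "q \<in> B" for q
    using smooth_on_has_derivative[OF smooth] that by (simp add: B_def)
  have dN: "(N has_derivative (\<lambda>v. s *\<^sub>R frechet_derivative n (at q) v)) (at q)" if q: "q \<in> B" for q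
    by (rule has_derivative_transform_within_open[OF has_derivative_scaleR_right[OF dn[OF q]] B q])
      (simp add: N)
  have fN: "frechet_derivative N (at q) = (\<lambda>v. s *\<^sub>R frechet_derivative n (at q) v)" if "q \<in> B" for q
    using frechet_derivative_at[OF dN[OF that]] by simp
  show ?thesis
  proof (intro exI[of _ B] conjI ballI allI)
    show "open B" "p \<in> B" "B \<subseteq> U" using B pB V by (auto simp: B_def)
    show "tmb_normal \<Omega> differentiable (at q)" if "q \<in> B" for q
      using dN[OF that] by (auto simp: N_def differentiable_def)
    show "continuous_on B (\<lambda>q. frechet_derivative (tmb_normal \<Omega>) (at q) v)" for v
    proof -
      have "continuous_on V (\<lambda>q. frechet_derivative n (at q) v)"
        by (rule smooth_on_continuous_on[OF smooth_on_frechet_derivative[OF smooth]])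
      then have "continuous_on B (\<lambda>q. s *\<^sub>R frechet_derivative n (at q) v)"
        by (intro continuous_on_scaleR continuous_on_const) (rule continuous_on_subset, auto simp: B_def)
      then show ?thesis
        by (rule continuous_on_cong[THEN iffD1, rotated 2]) (auto simp: fN[unfolded N_def])
    qed
    show "immersive_at (\<lambda>r. (x r, tmb_normal \<Omega> r)) p"
    proof -
      have "smooth_on x U" using U(2) by (simp add: wavefront_on_def frontal_on_def)
      then have dx: "(x has_derivative frechet_derivative x (at p)) (at p)"
        using p by (rule smooth_on_has_derivative)
      have 1: "frechet_derivative (\<lambda>r. (x r, n r)) (at p)
          = (\<lambda>v. (frechet_derivative x (at p) v, frechet_derivative n (at p) v))"
        using frechet_derivative_at[OF has_derivative_Pair[OF dx dn[OF pB]]] by simp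
      have 2: "((\<lambda>r. (x r, N r)) has_derivative
          (\<lambda>v. (frechet_derivative x (at p) v, s *\<^sub>R frechet_derivative n (at p) v))) (at p)"
        by (rule has_derivative_Pair[OF dx dN[OF pB]])
      \<comment> \<open>Rescaling the second component by a nonzero number preserves
        injectivity.\<close>
      have "inj (\<lambda>v. (frechet_derivative x (at p) v, s *\<^sub>R frechet_derivative n (at p) v))"
        using imm s unfolding immersive_at_def 1 by (simp add: inj_on_def)
      then show ?thesis
        using 2 frechet_derivative_at[OF 2] by (auto simp: immersive_at_def differentiable_def N_def)
    qed
  qed
qed

section \<open>Neighborhoods, limits and parallel maps\<close>

text \<open>Lets (1) and (2), which quantify over open subsets of \<open>U\<close>, be read as
  eventual statements at \<open>p\<close>; intersecting with \<open>B\<close> keeps the neighborhood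
  inside \<open>U\<close>.\<close>

lemma eventually_nhds_subset:
  assumes "open B" "p \<in> B" "B \<subseteq> U"
  shows "(\<forall>\<^sub>F q in nhds p. P q) \<longleftrightarrow> (\<exists>V. open V \<and> p \<in> V \<and> V \<subseteq> U \<and> (\<forall>q\<in>V. P q))"
proof
  assume "\<forall>\<^sub>F q in nhds p. P q"
  then obtain S where "open S" "p \<in> S" "\<forall>q\<in>S. P q" by (auto simp: eventually_nhds)
  then show "\<exists>V. open V \<and> p \<in> V \<and> V \<subseteq> U \<and> (\<forall>q\<in>V. P q)"
    using assms by (intro exI[of _ "S \<inter> B"]) auto
qed (auto simp: eventually_nhds)

text \<open>Which of \<open>k1\<close> and \<open>k2\<close> is the larger may vary from point to
  point with the sign of \<open>\<lambda>\<^sub>\<Omega>\<close>. Both tend to plus infinity exactly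
  when the smaller does, and to minus infinity exactly when the larger does, so the labelling drops
  out.\<close>

lemma filterlim_principal_curvatures:
  fixes H s :: "'a \<Rightarrow> real"
  assumes s: "\<forall>\<^sub>F q in L. s q \<ge> 0"
    and k: "\<And>q. (k1 q = H q - s q \<and> k2 q = H q + s q) \<or> (k1 q = H q + s q \<and> k2 q = H q - s q)"
  shows "filterlim k1 at_top L \<and> filterlim k2 at_top L \<longleftrightarrow> filterlim (\<lambda>q. H q - s q) at_top L"
    and "filterlim k1 at_bot L \<and> filterlim k2 at_bot L \<longleftrightarrow> filterlim (\<lambda>q. H q + s q) at_bot L"
proof -
  have "(\<forall>\<^sub>F q in L. Z \<le> k1 q) \<and> (\<forall>\<^sub>F q in L. Z \<le> k2 q) \<longleftrightarrow> (\<forall>\<^sub>F q in L. Z \<le> H q - s q)" for Z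
    unfolding eventually_conj_iff[symmetric]
    by (rule eventually_cong[OF s]) (use k in \<open>smt (verit)\<close>)
  then show "filterlim k1 at_top L \<and> filterlim k2 at_top L \<longleftrightarrow> filterlim (\<lambda>q. H q - s q) at_top L"
    unfolding filterlim_at_top by blast
  have "(\<forall>\<^sub>F q in L. k1 q \<le> Z) \<and> (\<forall>\<^sub>F q in L. k2 q \<le> Z) \<longleftrightarrow> (\<forall>\<^sub>F q in L. H q + s q \<le> Z)" for Z
    unfolding eventually_conj_iff[symmetric]
    by (rule eventually_cong[OF s]) (use k in \<open>smt (verit)\<close>)
  then show "filterlim k1 at_bot L \<and> filterlim k2 at_bot L \<longleftrightarrow> filterlim (\<lambda>q. H q + s q) at_bot L"
    unfolding filterlim_at_bot by blast
qed

lemma jacobian_parallel: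
  fixes x n :: "real^2 \<Rightarrow> real^3"
  assumes "x differentiable (at q)" "n differentiable (at q)"
  shows "jacobian (\<lambda>r. x r + l *\<^sub>R n r) (at q) = jacobian x (at q) + l *\<^sub>R jacobian n (at q)"
proof -
  let ?J = "jacobian x (at q) + l *\<^sub>R jacobian n (at q)"
  have "((\<lambda>r. x r + l *\<^sub>R n r) has_derivative
      (\<lambda>v. jacobian x (at q) *v v + l *\<^sub>R (jacobian n (at q) *v v))) (at q)"
    using assms unfolding jacobian_works
    by (intro has_derivative_add has_derivative_scaleR_right)
  moreover have "(\<lambda>v. jacobian x (at q) *v v + l *\<^sub>R (jacobian n (at q) *v v)) = (*v) ?J"
    by (rule ext) (simp add: matrix_vector_mult_add_rdistrib scaleR_matrix_vector_assoc)
  ultimately have "((\<lambda>r. x r + l *\<^sub>R n r) has_derivative (*v) ?J) (at q)" by (simp only:)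
  from frechet_derivative_at[OF this]
  have eq: "frechet_derivative (\<lambda>r. x r + l *\<^sub>R n r) (at q) = (*v) ?J" by (rule sym)
  have "jacobian (\<lambda>r. x r + l *\<^sub>R n r) (at q) = matrix ((*v) ?J)"
    unfolding jacobian_def[of "\<lambda>r. x r + l *\<^sub>R n r"] using eq by (rule arg_cong)
  also have "\<dots> = ?J" by (rule matrix_of_matrix_vector_mul)
  finally show ?thesis .
qed

theorem theorem5p1:
  fixes U :: "(real^2) set" and x :: "real^2 \<Rightarrow> real^3"
    and \<Omega> :: "real^2 \<Rightarrow> real^2^3" and p :: "real^2"
  defines "L \<equiv> at p within (U - singular_set x U)"
  defines "stmt1 \<equiv> parallelly_smoothable_at x \<Omega> U p"
    and "stmt2 \<equiv> (\<exists>V. open V \<and> p \<in> V \<and> V \<subseteq> U \<and>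
          (\<forall>q\<in>V. tmb_lambda x \<Omega> q * tmb_K \<Omega> q \<ge> 0) \<and> no_sign_change_on (tmb_H x \<Omega>) V)"
    and "stmt3 \<equiv> filterlim (gauss_curv x \<Omega>) at_top L \<and>
          (filterlim (mean_curv x \<Omega>) at_top L \<or> filterlim (mean_curv x \<Omega>) at_bot L)"
    and "stmt4 \<equiv> (filterlim (princ_curv1 x \<Omega>) at_top L \<and> filterlim (princ_curv2 x \<Omega>) at_top L) \<or>
          (filterlim (princ_curv1 x \<Omega>) at_bot L \<and> filterlim (princ_curv2 x \<Omega>) at_bot L)"
  assumes "open U"
    and "wavefront_on x U" and "proper_on x U"
    and "tangent_moving_basis \<Omega> x U"
    and "p \<in> singular_set x U" and "rank (jacobian x (at p)) = 0"
  shows "(stmt1 \<longleftrightarrow> stmt2) \<and> (stmt2 \<longleftrightarrow> stmt3) \<and> (stmt3 \<longleftrightarrow> stmt4)"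
proof -
  note t = \<open>tangent_moving_basis \<Omega> x U\<close>
  define R where "R = U - singular_set x U"
  define N where "N = tmb_normal \<Omega>"
  define a where "a = tmb_lambda x \<Omega>"
  define b where "b = tmb_H x \<Omega>"
  define c where "c = tmb_K \<Omega>"
  have p: "p \<in> U" using assms(10) by (simp add: singular_set_def)
  have smooth: "smooth_on x U" using assms(7) by (simp add: wavefront_on_def frontal_on_def)
  obtain B where B: "open B" "p \<in> B" "B \<subseteq> U"
    and normal_near: "\<forall>q\<in>B. N differentiable (at q)"
      "\<forall>v. continuous_on B (\<lambda>q. frechet_derivative N (at q) v)"
    and imm: "immersive_at (\<lambda>r. (x r, N r)) p"
    using tmb_normal_C1_near[OF assms(6,7,8) t p] unfolding N_def by (elim exE conjE)
  note Nd = normal_near(1)[rule_format] and Nc = normal_near(2)[rule_format]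
  have xd: "x differentiable (at q)" if "q \<in> B" for q
    using smooth_on_differentiable[OF smooth] that B by blast
  have cross: "cross3 (column 1 (\<Omega> q)) (column 2 (\<Omega> q)) \<noteq> 0" if "q \<in> B" for q
    using tangent_moving_basisD(1)[OF t] that B by blast
  have normal: "N q \<bullet> frechet_derivative x (at q) w = 0" if q: "q \<in> B" for q w
  proof -
    have "N q \<bullet> column j (jacobian x (at q)) = 0" for j
      unfolding N_def using tangent_moving_basisD(2)[OF t] q B by (intro inner_tmb_normal_eq_0) auto
    then show ?thesis
      unfolding frechet_derivative_eq_jacobian[OF xd[OF q]]
      by (simp add: matrix_mult_sum inner_sum_right scalar_mult_eq_scaleR)
  qed
  have unit: "N q \<bullet> frechet_derivative N (at q) v = 0" if q: "q \<in> B" for q v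
  proof -
    have "(N has_derivative frechet_derivative N (at q)) (at q)"
      using Nd[OF q] by (simp add: frechet_derivative_works)
    from has_derivative_inner[OF this this]
    have "((\<lambda>r. N r \<bullet> N r) has_derivative
        (\<lambda>v. N q \<bullet> frechet_derivative N (at q) v + frechet_derivative N (at q) v \<bullet> N q)) (at q)" .
    moreover have "((\<lambda>r. N r \<bullet> N r) has_derivative (\<lambda>v. 0)) (at q)"
      by (rule has_derivative_transform_within_open[OF has_derivative_const[of 1] B(1) q])
        (use norm_tmb_normal[OF cross] in \<open>simp add: N_def flip: power2_norm_eq_inner\<close>)
    ultimately have "(\<lambda>v. N q \<bullet> frechet_derivative N (at q) v + frechet_derivative N (at q) v \<bullet> N q) = (\<lambda>v. 0)"
      by (rule has_derivative_unique)
    from fun_cong[OF this, of v] show ?thesis by (simp add: inner_commute)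
  qed
  \<comment> \<open>Since n has unit length, Dn takes values in the plane of the basis; the
    factorization of Dn through \<open>\<Omega>\<close> rests on this.\<close>
  have Ncol: "column j (jacobian N (at q)) \<bullet> cross3 (column 1 (\<Omega> q)) (column 2 (\<Omega> q)) = 0" if "q \<in> B" for q j
    unfolding column_jacobian using unit[OF that] unfolding N_def by (rule inner_tmb_normal_eq_0_imp)
  have X: "jacobian x (at q) = \<Omega> q ** transpose (tmb_Lambda x \<Omega> q)" if "q \<in> B" for q
    using jacobian_eq_frame_coeffs[OF t] that B by blast
  have Y: "jacobian N (at q) = \<Omega> q ** transpose (tmb_mu \<Omega> q)" if "q \<in> B" for q
    unfolding N_def tmb_mu_eq by (rule frame_coeffs_mul) (use cross Ncol that in \<open>auto simp: N_def\<close>)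
  have sym: "second_form x \<Omega> q $ 2 $ 1 = second_form x \<Omega> q $ 1 $ 2" if q: "q \<in> B" for q
  proof -
    have "frechet_derivative x (at q) u \<bullet> frechet_derivative N (at q) v
        = frechet_derivative x (at q) v \<bullet> frechet_derivative N (at q) u" for u v
      by (rule normal_second_form_symmetric[OF B(1) q smooth_on_subset[OF smooth B(3)] Nd[OF q] normal])
    then show ?thesis
      unfolding second_form_def N_def[symmetric] by (simp add: transpose_mul_nth column_jacobian)
  qed
  have RB: "q \<in> R \<longleftrightarrow> a q \<noteq> 0" if "q \<in> B" for q
    using immersive_at_iff_tmb_lambda[OF t _ xd[OF that]] that B by (auto simp: R_def singular_set_def a_def)
  have curv: "gauss_curv x \<Omega> q = c q / a q" "mean_curv x \<Omega> q = b q / a q" "a q * c q \<le> (b q)\<^sup>2"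
    if "q \<in> B" "a q \<noteq> 0" for q
    using curvatures[OF t _ Ncol[unfolded N_def] sym] that B unfolding a_def b_def c_def by blast+
  \<comment> \<open>The curvature argument covers regular points; at singular ones the left side is
    0.\<close>
  have disc: "a q * c q \<le> (b q)\<^sup>2" if "q \<in> B" for q
    using curv(3) that by (cases "a q = 0") auto
  have dense: "B \<subseteq> closure R"
  proof
    fix q assume q: "q \<in> B"
    show "q \<in> closure R" unfolding closure_iff_nhds_not_empty
    proof (intro allI impI)
      fix A V assume V: "V \<subseteq> A" "open V" "q \<in> V"
      show "R \<inter> A \<noteq> {}"
      proof
        assume "R \<inter> A = {}"
        then have "V \<inter> U \<subseteq> singular_set x U" using V by (auto simp: R_def)
        then have "q \<in> interior (singular_set x U)"
          using V q B assms(6) by (intro interiorI[of "V \<inter> U"]) auto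
        then show False using assms(8) by (simp add: proper_on_def)
      qed
    qed
  qed
  have cont\<Omega>: "continuous_on B \<Omega>"
    using t B(3) by (metis smooth_on_continuous_on continuous_on_subset tangent_moving_basis_def)
  have contX: "continuous_on B (\<lambda>q. jacobian x (at q))"
    by (intro continuous_on_jacobian continuous_on_subset[OF _ B(3)]
        smooth_on_continuous_on smooth_on_frechet_derivative[OF smooth])
  have contL: "continuous_on B (tmb_Lambda x \<Omega>)"
    unfolding tmb_Lambda_eq[abs_def] by (rule continuous_on_frame_coeffs[OF cont\<Omega> contX cross])
  have contM: "continuous_on B (tmb_mu \<Omega>)"
    unfolding tmb_mu_eq[abs_def] N_def[symmetric]
    by (rule continuous_on_frame_coeffs[OF cont\<Omega> continuous_on_jacobian[OF Nc] cross])
  have conta: "continuous_on B a"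
    unfolding a_def tmb_lambda_def[abs_def] by (rule continuous_on_det_2x2[OF contL])
  have contc: "continuous_on B c"
    unfolding c_def tmb_K_def[abs_def] by (rule continuous_on_det_2x2[OF contM])
  have contb: "continuous_on B b"
    unfolding b_def tmb_H_def[abs_def] trace_def
    by (intro continuous_on_mult continuous_on_const continuous_on_sum continuous_on_component
        continuous_on_matrix_mul continuous_on_adj2 contL contM)
  have Dx0: "jacobian x (at p) = 0" using assms(11) by (simp add: rank_eq_0)
  have Lp: "tmb_Lambda x \<Omega> p = 0"
    by (simp add: tmb_Lambda_def Dx0 vec_eq_iff matrix_matrix_mult_def transpose_def)
  have ap: "a p = 0" by (simp add: a_def tmb_lambda_def Lp det_2)
  have bp: "b p = 0"
    by (simp add: b_def tmb_H_def Lp trace_def sum_2 matrix_matrix_mult_def adj2_def)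
  \<comment> \<open>As Dx vanishes at \<open>p\<close>, injectivity of the derivative of (x, n)
    falls entirely on Dn, which therefore has rank 2 and makes \<open>tmb_mu \<Omega> p\<close>
    invertible.\<close>
  have cp: "c p \<noteq> 0"
  proof -
    have dx: "(x has_derivative (\<lambda>v. 0)) (at p)"
    proof -
      have "(\<lambda>v. (0 :: real^2^3) *v v) = (\<lambda>v. 0)" by (rule ext) simp
      then show ?thesis using xd[OF B(2)] unfolding jacobian_works Dx0 by (simp only:)
    qed
    have dN: "(N has_derivative frechet_derivative N (at p)) (at p)"
      using Nd[OF B(2)] by (simp add: frechet_derivative_works)
    have "inj (\<lambda>v. (0 :: real^3, frechet_derivative N (at p) v))"
      using imm frechet_derivative_at[OF has_derivative_Pair[OF dx dN]] by (simp add: immersive_at_def)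
    then have "inj (frechet_derivative N (at p))" by (simp add: inj_on_def)
    then have "immersive_at N p" using Nd[OF B(2)] by (simp add: immersive_at_def)
    then have "rank (jacobian N (at p)) = 2" using immersive_at_iff_rank[OF Nd[OF B(2)]] by blast
    then show ?thesis
      using Y[OF B(2)] rank_frame_mul[OF cross[OF B(2)]] by (simp add: c_def tmb_K_def)
  qed
  have par: "rank (jacobian (\<lambda>r. x r + l *\<^sub>R N r) (at q)) = 2 \<longleftrightarrow> a q - 2 * l * b q + l\<^sup>2 * c q \<noteq> 0"
    if q: "q \<in> B" for q l
  proof -
    have "jacobian (\<lambda>r. x r + l *\<^sub>R N r) (at q)
        = \<Omega> q ** transpose (tmb_Lambda x \<Omega> q + l *\<^sub>R tmb_mu \<Omega> q)"
      unfolding jacobian_parallel[OF xd[OF q] Nd[OF q]] X[OF q] Y[OF q]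
      by (simp add: vec_eq_iff matrix_matrix_mult_def transpose_def sum_2 algebra_simps)
    then show ?thesis
      using rank_frame_mul[OF cross[OF q]] det_add_scaleR_2x2
      by (simp add: a_def b_def c_def tmb_lambda_def tmb_H_def tmb_K_def)
  qed
  define semidefinite where "semidefinite \<longleftrightarrow> (\<forall>\<^sub>F q in nhds p. a q * c q \<ge> 0) \<and>
    ((\<forall>\<^sub>F q in nhds p. b q \<ge> 0) \<or> (\<forall>\<^sub>F q in nhds p. b q \<le> 0))"
  note equiv = curvature_blowup[OF B(1,2) dense conta contb contc ap bp cp disc RB,
      where K = "gauss_curv x \<Omega>" and H = "mean_curv x \<Omega>", folded semidefinite_def, folded L_def[folded R_def]]
  have evB: "\<forall>\<^sub>F q in nhds p. q \<in> B" using B by (intro eventually_nhds_in_open)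
  have par_ev: "(\<forall>\<^sub>F q in nhds p. \<forall>l\<in>I. rank (jacobian (\<lambda>r. x r + l *\<^sub>R N r) (at q)) = 2)
      \<longleftrightarrow> (\<forall>\<^sub>F q in nhds p. \<forall>l\<in>I. a q - 2 * l * b q + l\<^sup>2 * c q \<noteq> 0)" for I
    by (rule eventually_cong[OF evB]) (simp add: par)
  have "stmt1 \<longleftrightarrow>
      (\<exists>\<epsilon>>0. \<forall>\<^sub>F q in nhds p. \<forall>l\<in>{0<..<\<epsilon>}. rank (jacobian (\<lambda>r. x r + l *\<^sub>R N r) (at q)) = 2) \<or>
      (\<exists>\<epsilon>>0. \<forall>\<^sub>F q in nhds p. \<forall>l\<in>{-\<epsilon><..<0}. rank (jacobian (\<lambda>r. x r + l *\<^sub>R N r) (at q)) = 2)"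
    unfolding stmt1_def parallelly_smoothable_at_def N_def eventually_nhds_subset[OF B]
    by (simp only: conj_disj_distribL ex_disj_distrib)
  also have "\<dots> \<longleftrightarrow> semidefinite"
    unfolding par_ev by (rule equiv(1)) (use RB curv in auto)
  finally have 1: "stmt1 \<longleftrightarrow> semidefinite" .
  have "stmt2 \<longleftrightarrow> (\<forall>\<^sub>F q in nhds p. a q * c q \<ge> 0 \<and> b q \<ge> 0) \<or> (\<forall>\<^sub>F q in nhds p. a q * c q \<ge> 0 \<and> b q \<le> 0)"
    unfolding stmt2_def no_sign_change_on_def a_def b_def c_def eventually_nhds_subset[OF B]
    by (simp only: conj_disj_distribL ex_disj_distrib ball_conj_distrib)
  then have 2: "stmt2 \<longleftrightarrow> semidefinite" unfolding semidefinite_def eventually_conj_iff by blast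
  have 3: "stmt3 \<longleftrightarrow> semidefinite"
    unfolding stmt3_def by (rule equiv(2)) (use RB curv in auto)
  let ?s = "\<lambda>q. sqrt ((mean_curv x \<Omega> q)\<^sup>2 - gauss_curv x \<Omega> q)"
  \<comment> \<open>\<open>sqrt\<close> takes negative values at negative arguments, so this amounts
    to K \<le> H^2, which is known at the regular points of \<open>B\<close>.\<close>
  have evs: "\<forall>\<^sub>F q in L. ?s q \<ge> 0"
  proof -
    have "L \<le> nhds p" unfolding L_def by (rule at_within_le_nhds)
    then have "\<forall>\<^sub>F q in L. q \<in> B" using evB filter_leD by blast
    moreover have "\<forall>\<^sub>F q in L. q \<in> R" unfolding L_def R_def by (simp add: eventually_at_topological) blast
    ultimately show ?thesis
    proof eventually_elim
      case (elim q)
      then have "a q \<noteq> 0" using RB by blast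
      then have "c q / a q = a q * c q / (a q)\<^sup>2" by (simp add: power2_eq_square)
      also have "\<dots> \<le> (b q)\<^sup>2 / (a q)\<^sup>2" using disc elim by (intro divide_right_mono) auto
      finally show ?case using curv elim \<open>a q \<noteq> 0\<close> by (simp add: power_divide)
    qed
  qed
  have k: "(princ_curv1 x \<Omega> q = mean_curv x \<Omega> q - ?s q \<and> princ_curv2 x \<Omega> q = mean_curv x \<Omega> q + ?s q) \<or>
      (princ_curv1 x \<Omega> q = mean_curv x \<Omega> q + ?s q \<and> princ_curv2 x \<Omega> q = mean_curv x \<Omega> q - ?s q)" for q
    by (simp add: princ_curv1_def princ_curv2_def Let_def)
  have 4: "stmt4 \<longleftrightarrow> semidefinite"
    unfolding stmt4_def filterlim_principal_curvatures[OF evs k]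
    by (rule equiv(3)) (use RB curv in auto)
  from 1 2 3 4 show ?thesis by blast
qed

end
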